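(* Let $l\in\mathbb N-\frac12$. There is a unique homomorphism of associative algebras $\Phi_l:U(\tilde{\mathfrak g}^{(l)})\to U(\tilde{\mathcal H}^{(l)})_{(z)}$ which restricts to the identity on $U(\tilde{\mathcal H}^{(l)})$ and satisfies $$\Phi_l(e)=E:=\frac{1}{z}\sum_{k=1}^{2l}(-1)^{k+l+\frac12}\frac{l-k}{(k-1)!(2l-k)!}\,p_{k-1}p_{2l-k},$$ $$\Phi_l(f)=F:=\frac{1}{z}\sum_{k=1}^{2l}(-1)^{k+l-\frac12}\frac{l-k}{(k-1)!(2l-k)!}\,p_{k}p_{2l-k+1},$$ $$\Phi_l(h)=H:=\frac{2}{z}\sum_{k=0}^{l-\frac12}(-1)^{k+l-\frac12}\frac{l-k}{k!(2l-k)!}\,p_{2l-k}p_k-\frac{(l+\frac12)^2}{2}.$$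
   Context: For $l\in\mathbb N-\frac12=\{\frac12,\frac32,\dots\}$, $\tilde{\mathfrak g}^{(l)}$ is the complex Lie algebra with basis $e,h,f,p_0,\dots,p_{2l},z$ and brackets $[h,e]=2e$, $[h,f]=-2f$, $[e,f]=h$, $[h,p_k]=2(l-k)p_k$, $[e,p_k]=kp_{k-1}$, $[f,p_k]=(2l-k)p_{k+1}$ (with $p_{-1}=p_{2l+1}=0$), $z$ central, and $[p_k,p_{k'}]=\delta_{k+k',2l}(-1)^{k+l+\frac12}k!(2l-k)!\,z$ for $k,k'=0,\dots,2l$. $\tilde{\mathcal H}^{(l)}=\mathrm{span}\{p_0,\dots,p_{2l},z\}$ is its Heisenberg subalgebra. $U(\cdot)$ denotes the universal enveloping algebra, and $U(\tilde{\mathcal H}^{(l)})_{(z)}$ is the localization of $U(\tilde{\mathcal H}^{(l)})$ at the multiplicative set $\{z^i: i\ge 0\}$ ($z$ is central, so this is an Ore localization). *)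

theory Defs
  imports Complex_Main "HOL-Algebra.QuotRing"
begin

text \<open>Generators: e, h, f, p_k, z.  We write l = n + 1/2 with n :: nat, so 2l = 2n+1.\<close>
datatype gen = GE | GH | GF | GP nat | GZ

definition free_alg :: "'g set \<Rightarrow> ('g list \<Rightarrow> complex) ring" where
  "free_alg S = \<lparr> carrier = {f. finite {w. f w \<noteq> 0} \<and> (\<forall>w. f w \<noteq> 0 \<longrightarrow> set w \<subseteq> S)},
      mult = (\<lambda>f g w. \<Sum>i\<le>length w. f (take i w) * g (drop i w)),
      one = (\<lambda>w. if w = [] then 1 else 0),
      zero = (\<lambda>w. 0),
      add = (\<lambda>f g w. f w + g w) \<rparr>"

definition fa_gen :: "'g \<Rightarrow> ('g list \<Rightarrow> complex)" where
  "fa_gen x = (\<lambda>w. if w = [x] then 1 else 0)"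

definition fa_scal :: "complex \<Rightarrow> ('g list \<Rightarrow> complex)" where
  "fa_scal c = (\<lambda>w. if w = [] then c else 0)"

definition fa_smult :: "complex \<Rightarrow> ('g list \<Rightarrow> complex) \<Rightarrow> ('g list \<Rightarrow> complex)" where
  "fa_smult c f = (\<lambda>w. c * f w)"

definition fa_mult :: "('g list \<Rightarrow> complex) \<Rightarrow> ('g list \<Rightarrow> complex) \<Rightarrow> ('g list \<Rightarrow> complex)" where
  "fa_mult f g = (\<lambda>w. \<Sum>i\<le>length w. f (take i w) * g (drop i w))"

definition lc :: "nat \<Rightarrow> complex" where "lc n = of_nat n + 1/2"

fun br :: "nat \<Rightarrow> gen \<Rightarrow> gen \<Rightarrow> (gen list \<Rightarrow> complex)" where
  "br n GH GE = fa_smult 2 (fa_gen GE)"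
| "br n GE GH = fa_smult (-2) (fa_gen GE)"
| "br n GH GF = fa_smult (-2) (fa_gen GF)"
| "br n GF GH = fa_smult 2 (fa_gen GF)"
| "br n GE GF = fa_gen GH"
| "br n GF GE = fa_smult (-1) (fa_gen GH)"
| "br n GH (GP k) = fa_smult (2 * (lc n - of_nat k)) (fa_gen (GP k))"
| "br n (GP k) GH = fa_smult (- 2 * (lc n - of_nat k)) (fa_gen (GP k))"
| "br n GE (GP k) = (if k = 0 then (\<lambda>w. 0) else fa_smult (of_nat k) (fa_gen (GP (k - 1))))"
| "br n (GP k) GE = (if k = 0 then (\<lambda>w. 0) else fa_smult (- of_nat k) (fa_gen (GP (k - 1))))"
| "br n GF (GP k) = (if k \<ge> 2*n+1 then (\<lambda>w. 0)
                      else fa_smult (of_nat (2*n+1) - of_nat k) (fa_gen (GP (k + 1))))"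
| "br n (GP k) GF = (if k \<ge> 2*n+1 then (\<lambda>w. 0)
                      else fa_smult (- (of_nat (2*n+1) - of_nat k)) (fa_gen (GP (k + 1))))"
| "br n (GP k) (GP k') = (if k + k' = 2*n+1
       then fa_smult ((-1) ^ (k + n + 1) * of_nat (fact k * fact (2*n+1-k))) (fa_gen GZ)
       else (\<lambda>w. 0))"
| "br n _ _ = (\<lambda>w. 0)"

definition gens_g :: "nat \<Rightarrow> gen set" where
  "gens_g n = {GE, GH, GF, GZ} \<union> GP ` {..2*n+1}"

definition gens_H :: "nat \<Rightarrow> gen set" where
  "gens_H n = {GZ} \<union> GP ` {..2*n+1}"

definition rels :: "nat \<Rightarrow> gen set \<Rightarrow> (gen list \<Rightarrow> complex) set" where
  "rels n S = {(\<lambda>w. fa_mult (fa_gen x) (fa_gen y) w - fa_mult (fa_gen y) (fa_gen x) w - br n x y w)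
               | x y. x \<in> S \<and> y \<in> S}"

definition env_alg :: "nat \<Rightarrow> gen set \<Rightarrow> (gen list \<Rightarrow> complex) set ring" where
  "env_alg n S = free_alg S Quot genideal (free_alg S) (rels n S)"

definition env_cls :: "nat \<Rightarrow> gen set \<Rightarrow> (gen list \<Rightarrow> complex) \<Rightarrow> (gen list \<Rightarrow> complex) set" where
  "env_cls n S a = genideal (free_alg S) (rels n S) +>\<^bsub>free_alg S\<^esub> a"

abbreviation "Ug n \<equiv> env_alg n (gens_g n)"
abbreviation "UH n \<equiv> env_alg n (gens_H n)"
abbreviation "clsg n \<equiv> env_cls n (gens_g n)"
abbreviation "clsH n \<equiv> env_cls n (gens_H n)"

text \<open>Localization of a ring R at the powers of a central element s:
  classes of fractions a / s^i, (a,i) ~ (b,j) iff s^k (s^j a - s^i b) = 0 for some k.\<close>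
definition loc_rel :: "('a, 'b) ring_scheme \<Rightarrow> 'a \<Rightarrow> ('a \<times> nat) rel" where
  "loc_rel R s = {((a, i), (b, j)). a \<in> carrier R \<and> b \<in> carrier R \<and>
      (\<exists>k::nat. s [^]\<^bsub>R\<^esub> (j + k) \<otimes>\<^bsub>R\<^esub> a = s [^]\<^bsub>R\<^esub> (i + k) \<otimes>\<^bsub>R\<^esub> b)}"

definition frac :: "('a, 'b) ring_scheme \<Rightarrow> 'a \<Rightarrow> 'a \<Rightarrow> nat \<Rightarrow> ('a \<times> nat) set" where
  "frac R s a i = loc_rel R s `` {(a, i)}"

definition localization :: "('a, 'b) ring_scheme \<Rightarrow> 'a \<Rightarrow> ('a \<times> nat) set ring" where
  "localization R s = \<lparr> carrier = (carrier R \<times> UNIV) // loc_rel R s,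
      mult = (\<lambda>X Y. \<Union>(a, i)\<in>X. \<Union>(b, j)\<in>Y. frac R s (a \<otimes>\<^bsub>R\<^esub> b) (i + j)),
      one = frac R s \<one>\<^bsub>R\<^esub> 0,
      zero = frac R s \<zero>\<^bsub>R\<^esub> 0,
      add = (\<lambda>X Y. \<Union>(a, i)\<in>X. \<Union>(b, j)\<in>Y.
               frac R s ((s [^]\<^bsub>R\<^esub> j \<otimes>\<^bsub>R\<^esub> a) \<oplus>\<^bsub>R\<^esub> (s [^]\<^bsub>R\<^esub> i \<otimes>\<^bsub>R\<^esub> b)) (i + j)) \<rparr>"

abbreviation "zH n \<equiv> clsH n (fa_gen GZ)"
abbreviation "ULoc n \<equiv> localization (UH n) (zH n)"
definition loc_map :: "nat \<Rightarrow> (gen list \<Rightarrow> complex) set \<Rightarrow> ((gen list \<Rightarrow> complex) set \<times> nat) set" where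
  "loc_map n a = frac (UH n) (zH n) a 0"

definition zinv :: "nat \<Rightarrow> ((gen list \<Rightarrow> complex) set \<times> nat) set" where
  "zinv n = frac (UH n) (zH n) \<one>\<^bsub>UH n\<^esub> 1"

definition E_sum :: "nat \<Rightarrow> (gen list \<Rightarrow> complex)" where
  "E_sum n = (\<lambda>w. \<Sum>k\<in>{1..2*n+1}.
      ((-1) ^ (k + n + 1) * (lc n - of_nat k) / (of_nat (fact (k - 1)) * of_nat (fact (2*n+1-k))))
      * fa_mult (fa_gen (GP (k - 1))) (fa_gen (GP (2*n+1-k))) w)"

definition F_sum :: "nat \<Rightarrow> (gen list \<Rightarrow> complex)" where
  "F_sum n = (\<lambda>w. \<Sum>k\<in>{1..2*n+1}.
      ((-1) ^ (k + n) * (lc n - of_nat k) / (of_nat (fact (k - 1)) * of_nat (fact (2*n+1-k))))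
      * fa_mult (fa_gen (GP k)) (fa_gen (GP (2*n+1-k+1))) w)"

definition H_sum :: "nat \<Rightarrow> (gen list \<Rightarrow> complex)" where
  "H_sum n = (\<lambda>w. \<Sum>k\<in>{0..n}.
      ((-1) ^ (k + n) * (lc n - of_nat k) / (of_nat (fact k) * of_nat (fact (2*n+1-k))))
      * fa_mult (fa_gen (GP (2*n+1-k))) (fa_gen (GP k)) w)"

definition Eel :: "nat \<Rightarrow> ((gen list \<Rightarrow> complex) set \<times> nat) set" where
  "Eel n = zinv n \<otimes>\<^bsub>ULoc n\<^esub> loc_map n (clsH n (E_sum n))"

definition Fel :: "nat \<Rightarrow> ((gen list \<Rightarrow> complex) set \<times> nat) set" where
  "Fel n = zinv n \<otimes>\<^bsub>ULoc n\<^esub> loc_map n (clsH n (F_sum n))"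

definition Hel :: "nat \<Rightarrow> ((gen list \<Rightarrow> complex) set \<times> nat) set" where
  "Hel n = (loc_map n (clsH n (fa_scal 2)) \<otimes>\<^bsub>ULoc n\<^esub> zinv n \<otimes>\<^bsub>ULoc n\<^esub> loc_map n (clsH n (H_sum n)))
           \<ominus>\<^bsub>ULoc n\<^esub> loc_map n (clsH n (fa_scal ((lc n + 1/2)^2 / 2)))"

definition Phi_prop :: "nat \<Rightarrow> ((gen list \<Rightarrow> complex) set \<Rightarrow> ((gen list \<Rightarrow> complex) set \<times> nat) set) \<Rightarrow> bool" where
  "Phi_prop n \<Phi> \<longleftrightarrow>
     \<Phi> \<in> ring_hom (Ug n) (ULoc n) \<and>
     (\<forall>c. \<forall>x\<in>carrier (Ug n). \<Phi> (clsg n (fa_scal c) \<otimes>\<^bsub>Ug n\<^esub> x)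
          = loc_map n (clsH n (fa_scal c)) \<otimes>\<^bsub>ULoc n\<^esub> \<Phi> x) \<and>
     (\<forall>a\<in>carrier (free_alg (gens_H n)). \<Phi> (clsg n a) = loc_map n (clsH n a)) \<and>
     \<Phi> (clsg n (fa_gen GE)) = Eel n \<and>
     \<Phi> (clsg n (fa_gen GF)) = Fel n \<and>
     \<Phi> (clsg n (fa_gen GH)) = Hel n"

end

theory Submission
  imports Defs
begin

text \<open>
  Each of $E$, $F$, $H$ is a combination of quadratic elements $z^{-1} p_i p_j$, so by the Leibniz rule
  and $[p_i, p_j] \in \mathbb{C} z$ its commutators with the $p_m$ are linear in the $p_k$, and they agree
  with the action of $e$, $f$, $h$.  Hence $[E,F]$ follows from applying the derivation $[E,\cdot]$
  to $F$.  This gives a sum of terms $p_j p_{2l-j}$ over all $j$; reordering the terms with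
  $j \<le> l$ yields the quadratic part of $H$ and the constant $-(l+1/2)^2/2$.  So the assignment on
  generators kills the relations of $U(\tilde{g})$.  Uniqueness holds because all generators are prescribed.
\<close>

section \<open>Transfer of carrier-based rings to the type class\<close>

text \<open>The formulas simplify once the factorials are absorbed into the structure constants c_k
  of [p_k, p_{2l-k}] = c_k z. The coefficients of E and F are then plus or minus (l-k)k/c_k, and
  those in the sum of H are -(l-k)/c_k. A commutator with some p_m produces a multiple c_j z; the
  inverse of z removes z, and c_j cancels the denominator up to sign, so that only polynomial
  identities in l and the indices remain.

  The shape of the formalization is dictated by the target, a localization of a quotient, given as a
  record with a carrier. Commutator calculus is pleasant only in a type of class
  \<open>ring\<close>, so it is carried out in an abstract locale with elements \<open>p k\<close>,
  \<open>z\<close>, \<open>zi\<close> and a scalar map \<open>sc\<close>; afterwards the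
  localization is shown to contain such a configuration. The homomorphism is defined on the free
  algebra by evaluation and descends because the relations go to zero.\<close>

text \<open>
  The product of all rings with carrier in \<open>'a\<close> is a type of class \<open>ring\<close>, and every such ring embeds
  into it as a factor, so that identities in a carrier-based ring may be computed in the type class.
  The embedding does not preserve the unit, hence the hypotheses of the form
  \<open>sc 1 * x = x\<close> below.
\<close>

typedef 'a fam = "{F :: 'a ring \<Rightarrow> 'a. \<forall>R. if Ring.ring R then F R \<in> carrier R else F R = undefined}"
  by (rule exI[of _ "\<lambda>R. if Ring.ring R then \<zero>\<^bsub>R\<^esub> else undefined"]) (auto simp: ring.ring_simprules)

setup_lifting type_definition_fam

instantiation fam :: (type) ring
begin
lift_definition zero_fam :: "'a fam" is "\<lambda>R. if Ring.ring R then \<zero>\<^bsub>R\<^esub> else undefined"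
  by (simp add: ring.ring_simprules)
lift_definition plus_fam :: "'a fam \<Rightarrow> 'a fam \<Rightarrow> 'a fam"
  is "\<lambda>F G R. if Ring.ring R then F R \<oplus>\<^bsub>R\<^esub> G R else undefined"
  by (metis ring.ring_simprules(1))
lift_definition uminus_fam :: "'a fam \<Rightarrow> 'a fam"
  is "\<lambda>F R. if Ring.ring R then \<ominus>\<^bsub>R\<^esub> F R else undefined"
  by (metis ring.ring_simprules(3))
lift_definition minus_fam :: "'a fam \<Rightarrow> 'a fam \<Rightarrow> 'a fam"
  is "\<lambda>F G R. if Ring.ring R then F R \<ominus>\<^bsub>R\<^esub> G R else undefined"
  by (metis ring.ring_simprules(4))
lift_definition times_fam :: "'a fam \<Rightarrow> 'a fam \<Rightarrow> 'a fam"
  is "\<lambda>F G R. if Ring.ring R then F R \<otimes>\<^bsub>R\<^esub> G R else undefined"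
  by (metis ring.ring_simprules(5))
instance
proof
  fix a b c :: "'a fam"
  show "a * b * c = a * (b * c)"
    by transfer (auto simp: fun_eq_iff ring.ring_simprules)
  show "a + b + c = a + (b + c)"
    by transfer (auto simp: fun_eq_iff ring.ring_simprules)
  show "a + b = b + a"
    by transfer (auto simp: fun_eq_iff ring.ring_simprules)
  show "0 + a = a"
    by transfer (auto simp: fun_eq_iff ring.ring_simprules)
  show "- a + a = 0"
    by transfer (auto simp: fun_eq_iff ring.ring_simprules)
  show "a - b = a + - b"
    by transfer (auto simp: fun_eq_iff ring.ring_simprules)
  show "(a + b) * c = a * c + b * c"
    by transfer (auto simp: fun_eq_iff ring.ring_simprules)
  show "a * (b + c) = a * b + a * c"
    by transfer (auto simp: fun_eq_iff ring.ring_simprules)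
qed
end

text \<open>\<open>component R\<close> is a ring homomorphism on the whole of \<open>'a fam\<close>,
  not only on the range of \<open>single R\<close>. Hence anything computed in the type can be
  brought back to \<open>R\<close>.\<close>

lift_definition component :: "'a ring \<Rightarrow> 'a fam \<Rightarrow> 'a" is "\<lambda>R F. F R" .

lift_definition single :: "'a ring \<Rightarrow> 'a \<Rightarrow> 'a fam"
  is "\<lambda>R x R'. if Ring.ring R' then if R' = R \<and> x \<in> carrier R then x else \<zero>\<^bsub>R'\<^esub> else undefined"
  by (auto simp: ring.ring_simprules)

lemma component_closed: "Ring.ring R \<Longrightarrow> component R F \<in> carrier R"
  by transfer (metis (full_types))

lemma component_hom:
  assumes "Ring.ring R"
  shows "component R 0 = \<zero>\<^bsub>R\<^esub>" "component R (F + G) = component R F \<oplus>\<^bsub>R\<^esub> component R G" "component R (F * G) = component R F \<otimes>\<^bsub>R\<^esub> component R G"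
  by (use assms in \<open>transfer, simp\<close>)+

lemma component_single: "Ring.ring R \<Longrightarrow> x \<in> carrier R \<Longrightarrow> component R (single R x) = x"
  by transfer simp

lemma single_hom:
  assumes "Ring.ring R" "x \<in> carrier R" "y \<in> carrier R"
  shows "single R (x \<oplus>\<^bsub>R\<^esub> y) = single R x + single R y"
    and "single R (x \<ominus>\<^bsub>R\<^esub> y) = single R x - single R y"
    and "single R (x \<otimes>\<^bsub>R\<^esub> y) = single R x * single R y"
  by (use assms in \<open>transfer, auto simp: fun_eq_iff ring.ring_simprules\<close>)+

section \<open>The free algebra and evaluation of its elements\<close>

text \<open>Summing over factorizations of \<open>w\<close> instead of cut positions turns
  rearrangements of convolutions into bijections of index sets.\<close>

lemma splits_sum:
  fixes h :: "'g list \<Rightarrow> 'g list \<Rightarrow> 'b::comm_monoid_add"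
  shows "(\<Sum>i\<le>length w. h (take i w) (drop i w)) = (\<Sum>(u, v) | u @ v = w. h u v)"
  by (rule sum.reindex_bij_witness[of _ "\<lambda>(u, v). length u" "\<lambda>i. (take i w, drop i w)"]) auto

lemma finite_splits: "finite {(u, v). u @ v = w}"
proof (rule finite_subset)
  show "{(u, v). u @ v = w} \<subseteq> (\<lambda>i. (take i w, drop i w)) ` {..length w}"
  proof clarify
    fix u v assume "w = u @ v"
    then show "(u, v) \<in> (\<lambda>i. (take i (u @ v), drop i (u @ v))) ` {..length (u @ v)}"
      by (intro image_eqI[of _ _ "length u"]) auto
  qed
qed auto

lemma free_alg_simps [simp]:
  "f \<oplus>\<^bsub>free_alg S\<^esub> g = (\<lambda>w. f w + g w)"
  "f \<otimes>\<^bsub>free_alg S\<^esub> g = fa_mult f g"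
  "\<zero>\<^bsub>free_alg S\<^esub> = (\<lambda>w. 0)"
  "\<one>\<^bsub>free_alg S\<^esub> = fa_scal 1"
  by (auto simp: free_alg_def fa_mult_def fa_scal_def)

lemma mem_free_alg:
  "f \<in> carrier (free_alg S) \<longleftrightarrow> finite {w. f w \<noteq> 0} \<and> (\<forall>w. f w \<noteq> 0 \<longrightarrow> set w \<subseteq> S)"
  by (simp add: free_alg_def)

lemma fa_mult_eq: "fa_mult f g w = (\<Sum>(u, v) | u @ v = w. f u * g v)"
  unfolding fa_mult_def by (rule splits_sum)

lemma fa_mult_nonzero:
  assumes "fa_mult f g w \<noteq> 0" obtains u v where "w = u @ v" "f u \<noteq> 0" "g v \<noteq> 0"
proof -
  obtain i where "f (take i w) * g (drop i w) \<noteq> 0"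
    using assms unfolding fa_mult_def by (meson sum.not_neutral_contains_not_neutral)
  then show ?thesis by (intro that[of "take i w" "drop i w"]) auto
qed

lemma fa_mult_assoc: "fa_mult (fa_mult f g) h = fa_mult f (fa_mult g h)"
proof
  fix w
  have "fa_mult (fa_mult f g) h w
    = (\<Sum>(x, c) | x @ c = w. \<Sum>(a, b) | a @ b = x. f a * g b * h c)"
    by (simp add: fa_mult_eq sum_distrib_right case_prod_unfold)
  also have "\<dots> = (\<Sum>((x, c), (a, b))\<in>(SIGMA (x, c):{(x, c). x @ c = w}. {(a, b). a @ b = x}). f a * g b * h c)"
    by (subst sum.Sigma[symmetric]) (use finite_splits in \<open>auto simp: case_prod_unfold\<close>)
  \<comment> \<open>Both index sets parametrize the factorizations
    \<open>w = a @ b @ c\<close>.\<close>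
  also have "\<dots> = (\<Sum>((a, y), (b, c))\<in>(SIGMA (a, y):{(a, y). a @ y = w}. {(b, c). b @ c = y}). f a * g b * h c)"
    by (rule sum.reindex_bij_witness[of _ "\<lambda>((a, y), (b, c)). ((a @ b, c), (a, b))"
          "\<lambda>((x, c), (a, b)). ((a, b @ c), (b, c))"]) auto
  also have "\<dots> = (\<Sum>(a, y) | a @ y = w. \<Sum>(b, c) | b @ c = y. f a * g b * h c)"
    by (subst sum.Sigma[symmetric]) (use finite_splits in \<open>auto simp: case_prod_unfold\<close>)
  also have "\<dots> = fa_mult f (fa_mult g h) w"
    by (simp add: fa_mult_eq sum_distrib_left case_prod_unfold mult.assoc)
  finally show "fa_mult (fa_mult f g) h w = fa_mult f (fa_mult g h) w" .
qed

lemma fa_scal_mult: "fa_mult (fa_scal c) f = fa_smult c f"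
proof
  fix w
  have "fa_mult (fa_scal c) f w = (\<Sum>i\<le>length w. if i = 0 then c * f w else 0)"
    unfolding fa_mult_def fa_scal_def by (rule sum.cong) auto
  then show "fa_mult (fa_scal c) f w = fa_smult c f w"
    by (simp add: fa_smult_def)
qed

lemma mult_fa_scal: "fa_mult f (fa_scal c) = fa_smult c f"
proof
  fix w
  have "fa_mult f (fa_scal c) w = (\<Sum>i\<le>length w. if i = length w then c * f w else 0)"
    unfolding fa_mult_def fa_scal_def by (rule sum.cong) auto
  then show "fa_mult f (fa_scal c) w = fa_smult c f w"
    by (simp add: fa_smult_def)
qed

lemma fa_mult_closed:
  assumes "f \<in> carrier (free_alg S)" "g \<in> carrier (free_alg S)"
  shows "fa_mult f g \<in> carrier (free_alg S)"
proof -
  have "{w. fa_mult f g w \<noteq> 0} \<subseteq> (\<lambda>(u, v). u @ v) ` ({w. f w \<noteq> 0} \<times> {w. g w \<noteq> 0})"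
    by (auto elim!: fa_mult_nonzero)
  moreover have "set w \<subseteq> S" if "fa_mult f g w \<noteq> 0" for w
    using that assms by (elim fa_mult_nonzero) (simp add: mem_free_alg; blast)
  ultimately show ?thesis
    using assms by (auto simp: mem_free_alg intro: finite_subset)
qed

lemma fa_add_closed:
  assumes "f \<in> carrier (free_alg S)" "g \<in> carrier (free_alg S)"
  shows "(\<lambda>w. f w + g w) \<in> carrier (free_alg S)"
proof -
  have "{w. f w + g w \<noteq> 0} \<subseteq> {w. f w \<noteq> 0} \<union> {w. g w \<noteq> 0}" by auto
  with assms show ?thesis by (auto simp: mem_free_alg intro: finite_subset)
qed

lemma fa_scal_closed: "fa_scal c \<in> carrier (free_alg S)"
  by (auto simp: fa_scal_def mem_free_alg)

lemma fa_gen_closed: "x \<in> S \<Longrightarrow> fa_gen x \<in> carrier (free_alg S)"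
  by (auto simp: fa_gen_def mem_free_alg)

lemma fa_zero_closed: "(\<lambda>w. 0) \<in> carrier (free_alg S)"
  by (simp add: mem_free_alg)

lemma fa_smult_closed: "f \<in> carrier (free_alg S) \<Longrightarrow> fa_smult c f \<in> carrier (free_alg S)"
  by (metis fa_scal_mult fa_mult_closed fa_scal_closed)

lemma ring_free_alg: "Ring.ring (free_alg S)"
proof (rule ringI)
  show "abelian_group (free_alg S)"
  proof (rule abelian_groupI)
    fix f assume "f \<in> carrier (free_alg S)"
    then have "(\<lambda>w. - f w) \<in> carrier (free_alg S)" by (simp add: mem_free_alg)
    then show "\<exists>g\<in>carrier (free_alg S). g \<oplus>\<^bsub>free_alg S\<^esub> f = \<zero>\<^bsub>free_alg S\<^esub>"
      by (intro bexI[of _ "\<lambda>w. - f w"]) auto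
  next
    fix f g assume "f \<in> carrier (free_alg S)" "g \<in> carrier (free_alg S)"
    then show "f \<oplus>\<^bsub>free_alg S\<^esub> g \<in> carrier (free_alg S)"
      unfolding free_alg_simps(1) by (rule fa_add_closed)
  qed (simp_all add: add_ac fa_zero_closed)
  show "monoid (free_alg S)"
    by (rule monoidI; (unfold free_alg_simps(2))?;
        auto simp: fa_mult_closed fa_mult_assoc fa_scal_closed fa_scal_mult mult_fa_scal fa_smult_def)
qed (simp_all add: fa_mult_def sum.distrib distrib_left distrib_right)

lemma free_alg_minus:
  assumes "f \<in> carrier (free_alg S)" "g \<in> carrier (free_alg S)"
  shows "f \<ominus>\<^bsub>free_alg S\<^esub> g = (\<lambda>w. f w - g w)"
proof -
  interpret Ring.ring "free_alg S" by (rule ring_free_alg)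
  have "fa_smult (-1) g \<in> carrier (free_alg S)" using assms by (intro fa_smult_closed)
  then have "\<ominus>\<^bsub>free_alg S\<^esub> g = fa_smult (-1) g"
    using assms by (intro minus_equality) (simp_all only: free_alg_simps(1,3), simp_all add: fa_smult_def)
  then show ?thesis by (simp add: a_minus_def fa_smult_def)
qed

lemma fa_diff_closed:
  assumes "f \<in> carrier (free_alg S)" "g \<in> carrier (free_alg S)"
  shows "(\<lambda>w. f w - g w) \<in> carrier (free_alg S)"
  using free_alg_minus[OF assms] ring.ring_simprules(4)[OF ring_free_alg assms] by metis

lemma fa_mult_single_Cons: "fa_mult (fa_gen x) (\<lambda>v. if v = u then 1 else 0) = (\<lambda>v. if v = x # u then 1 else 0)"
proof
  fix w
  have "fa_mult (fa_gen x) (\<lambda>v. if v = u then 1 else 0) w = (\<Sum>s | fst s @ snd s = w. if s = ([x], u) then 1 else 0)"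
    unfolding fa_mult_eq fa_gen_def by (rule sum.cong) (auto split: if_splits)
  also have "\<dots> = (if w = x # u then 1 else 0)"
    using finite_splits[of w] by (subst sum.delta) (auto simp: case_prod_unfold)
  finally show "fa_mult (fa_gen x) (\<lambda>v. if v = u then 1 else 0) w = (if w = x # u then 1 else 0)" .
qed

text \<open>Words are iterated products of generators, and an element is a finite combination of
  words. Scaling needs no case of its own, being multiplication by \<open>fa_scal c\<close>.\<close>

lemma free_alg_induct [consumes 1, case_names scal gen add mult]:
  assumes f: "f \<in> carrier (free_alg S)"
    and scal: "\<And>c. P (fa_scal c)" and gen: "\<And>x. x \<in> S \<Longrightarrow> P (fa_gen x)"
    and add: "\<And>f g. f \<in> carrier (free_alg S) \<Longrightarrow> g \<in> carrier (free_alg S) \<Longrightarrow> P f \<Longrightarrow> P g \<Longrightarrow> P (\<lambda>w. f w + g w)"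
    and mult: "\<And>f g. f \<in> carrier (free_alg S) \<Longrightarrow> g \<in> carrier (free_alg S) \<Longrightarrow> P f \<Longrightarrow> P g \<Longrightarrow> P (fa_mult f g)"
  shows "P f"
proof -
  have word: "P (\<lambda>v. if v = u then 1 else 0) \<and> (\<lambda>v. if v = u then 1 else 0) \<in> carrier (free_alg S)"
    if "set u \<subseteq> S" for u
    using that
  proof (induction u)
    case Nil
    show ?case using scal[of 1] fa_scal_closed[of 1 S] by (simp add: fa_scal_def)
  next
    case (Cons x u)
    then show ?case
      using mult[OF fa_gen_closed, of x "\<lambda>v. if v = u then 1 else 0"] gen[of x]
        fa_mult_closed[OF fa_gen_closed, of x S "\<lambda>v. if v = u then 1 else 0"]
      by (simp add: fa_mult_single_Cons)
  qed
  \<comment> \<open>Induction on the part \<open>A\<close> of the support: restrictions of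
    \<open>f\<close> stay in the free algebra and differ by one scaled word.\<close>
  have "P (\<lambda>w. if w \<in> A then f w else 0)" if "finite A" "A \<subseteq> {w. f w \<noteq> 0}" for A
    using that
  proof (induction A)
    case empty
    show ?case using scal[of 0] by (simp add: fa_scal_def)
  next
    case (insert u A)
    then have "set u \<subseteq> S" using f by (auto simp: mem_free_alg)
    note u = word[OF this]
    have "P (fa_smult (f u) (\<lambda>v. if v = u then 1 else 0))"
      unfolding fa_scal_mult[symmetric] using u fa_scal_closed scal by (intro mult) auto
    then have "P (\<lambda>w. fa_smult (f u) (\<lambda>v. if v = u then 1 else 0) w + (if w \<in> A then f w else 0))"
      using insert f u by (intro add fa_smult_closed) (auto simp: mem_free_alg intro: finite_subset)
    also have "(\<lambda>w. fa_smult (f u) (\<lambda>v. if v = u then 1 else 0) w + (if w \<in> A then f w else 0))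
      = (\<lambda>w. if w \<in> insert u A then f w else 0)"
      using insert by (auto simp: fa_smult_def)
    finally show ?case .
  qed
  from this[of "{w. f w \<noteq> 0}"] f have "P (\<lambda>w. if f w \<noteq> 0 then f w else 0)" by (simp add: mem_free_alg)
  also have "(\<lambda>w. if f w \<noteq> 0 then f w else 0) = f" by auto
  finally show ?thesis .
qed

text \<open>\<open>ring_hom\<close> does not include linearity over the complex numbers, so
  agreement on scalars is a hypothesis besides agreement on generators.\<close>

lemma free_alg_hom_unique:
  assumes "\<phi> \<in> ring_hom (free_alg S) R" "\<psi> \<in> ring_hom (free_alg S) R"
    and "\<And>c. \<phi> (fa_scal c) = \<psi> (fa_scal c)" "\<And>x. x \<in> S \<Longrightarrow> \<phi> (fa_gen x) = \<psi> (fa_gen x)"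
    and "f \<in> carrier (free_alg S)"
  shows "\<phi> f = \<psi> f"
  using assms(5)
proof (induction rule: free_alg_induct)
  case (add f g)
  then show ?case
    using ring_hom_add[OF assms(1) add(1,2)] ring_hom_add[OF assms(2) add(1,2)] by simp
next
  case (mult f g)
  then show ?case
    using ring_hom_mult[OF assms(1) mult(1,2)] ring_hom_mult[OF assms(2) mult(1,2)] by simp
qed (use assms in auto)

section \<open>Evaluation of noncommutative polynomials\<close>

locale evaluation =
  fixes sc :: "complex \<Rightarrow> 't::ring" and \<gamma> :: "'g \<Rightarrow> 't"
  assumes sc_add: "sc (a + b) = sc a + sc b"
    and sc_mult: "sc (a * b) = sc a * sc b"
    and sc_gen: "sc a * \<gamma> x = \<gamma> x * sc a"
    and one_gen: "sc 1 * \<gamma> x = \<gamma> x"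
begin

lemma sc_0: "sc 0 = 0"
  using sc_add[of 0 0] by simp

lemma sc_sum: "sc (sum f A) = (\<Sum>i\<in>A. sc (f i))"
  by (induction A rule: infinite_finite_induct) (simp_all add: sc_add sc_0)

text \<open>The class \<open>ring\<close> provides no unit; \<open>sc 1\<close> takes its place as
  the value of the empty word.\<close>

definition word :: "'g list \<Rightarrow> 't" where
  "word w = foldr (\<lambda>x. (*) (\<gamma> x)) w (sc 1)"

lemma word_simps [simp]: "word [] = sc 1" "word (x # w) = \<gamma> x * word w"
  by (simp_all add: word_def)

lemma one_word: "sc 1 * word w = word w"
  by (cases w) (simp_all add: sc_mult[symmetric] mult.assoc[symmetric] one_gen)

lemma word_append: "word (u @ v) = word u * word v"
  by (induction u) (simp_all add: one_word mult.assoc)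

lemma sc_word: "sc a * word w = word w * sc a"
  by (induction w) (simp_all add: sc_mult[symmetric] mult.commute, metis mult.assoc sc_gen)

definition ev :: "('g list \<Rightarrow> complex) \<Rightarrow> 't" where
  "ev f = (\<Sum>w | f w \<noteq> 0. sc (f w) * word w)"

text \<open>Supports may shrink by cancellation in sums and products; any finite superset of the
  support may be summed over instead.\<close>

lemma ev_eq: "finite A \<Longrightarrow> {w. f w \<noteq> 0} \<subseteq> A \<Longrightarrow> ev f = (\<Sum>w\<in>A. sc (f w) * word w)"
  unfolding ev_def by (rule sum.mono_neutral_left) (auto simp: sc_0)

lemma ev_add:
  assumes "finite {w. f w \<noteq> 0}" "finite {w. g w \<noteq> 0}"
  shows "ev (\<lambda>w. f w + g w) = ev f + ev g"
proof -
  let ?A = "{w. f w \<noteq> 0} \<union> {w. g w \<noteq> 0}"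
  have "ev (\<lambda>w. f w + g w) = (\<Sum>w\<in>?A. sc (f w + g w) * word w)"
    using assms by (intro ev_eq) auto
  also have "\<dots> = (\<Sum>w\<in>?A. sc (f w) * word w) + (\<Sum>w\<in>?A. sc (g w) * word w)"
    by (simp add: sc_add distrib_right sum.distrib)
  also have "\<dots> = ev f + ev g"
    using assms by (simp add: ev_eq[of ?A f] ev_eq[of ?A g])
  finally show ?thesis .
qed

lemma ev_scal: "ev (fa_scal c) = sc c"
  by (subst ev_eq[of "{[]}"]) (auto simp: fa_scal_def sc_mult[symmetric])

lemma ev_gen: "ev (fa_gen x) = \<gamma> x"
  by (subst ev_eq[of "{[x]}"])
     (auto simp: fa_gen_def sc_gen[symmetric] sc_mult[symmetric] mult.assoc[symmetric] one_gen)

lemma ev_mult: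
  assumes f: "finite {w. f w \<noteq> 0}" and g: "finite {w. g w \<noteq> 0}"
  shows "ev (fa_mult f g) = ev f * ev g"
proof -
  let ?P = "{w. f w \<noteq> 0} \<times> {w. g w \<noteq> 0}"
  let ?A = "(\<lambda>(u, v). u @ v) ` ?P"
  let ?t = "\<lambda>u v. sc (f u) * word u * (sc (g v) * word v)"
  have t: "sc (f u * g v) * word (u @ v) = ?t u v" for u v
    by (simp add: sc_mult word_append) (metis mult.assoc sc_word)
  have "ev (fa_mult f g) = (\<Sum>w\<in>?A. sc (fa_mult f g w) * word w)"
    using f g by (intro ev_eq) (auto elim!: fa_mult_nonzero)
  \<comment> \<open>Pairs of words from the two supports are grouped by their concatenation;
    factorizations outside the supports contribute zero.\<close>
  also have "\<dots> = (\<Sum>w\<in>?A. \<Sum>x\<in>{x \<in> ?P. (\<lambda>(u, v). u @ v) x = w}. (\<lambda>(u, v). ?t u v) x)"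
  proof (intro sum.cong refl)
    fix w
    have "sc (fa_mult f g w) * word w = (\<Sum>(u, v) | u @ v = w. sc (f u * g v) * word w)"
      by (simp add: fa_mult_eq sc_sum sum_distrib_right case_prod_unfold)
    also have "\<dots> = (\<Sum>(u, v) | u @ v = w. ?t u v)"
      by (intro sum.cong refl) (auto simp: t[symmetric])
    also have "\<dots> = (\<Sum>x\<in>{x \<in> ?P. (\<lambda>(u, v). u @ v) x = w}. (\<lambda>(u, v). ?t u v) x)"
      by (rule sum.mono_neutral_right) (use finite_splits[of w] in \<open>auto simp: sc_0\<close>)
    finally show "sc (fa_mult f g w) * word w = \<dots>" .
  qed
  also have "\<dots> = (\<Sum>x\<in>?P. (\<lambda>(u, v). ?t u v) x)"
    using f g by (intro sum.group) auto
  also have "\<dots> = ev f * ev g"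
    by (simp add: ev_def sum_product sum.cartesian_product)
  finally show ?thesis .
qed

end

section \<open>Quadratic elements of a Heisenberg algebra\<close>

definition comm :: "'t::ring \<Rightarrow> 't \<Rightarrow> 't" where "comm x y = x * y - y * x"

lemma comm_mult_left: "comm (x * y) w = x * comm y w + comm x w * y"
  and comm_mult_right: "comm w (x * y) = x * comm w y + comm w x * y"
  by (simp_all add: comm_def algebra_simps)

lemma comm_diff_left: "comm (x - y) w = comm x w - comm y w"
  by (simp add: comm_def algebra_simps)

lemma comm_diff_right: "comm w (x - y) = comm w x - comm w y"
  by (simp add: comm_def algebra_simps)

lemma comm_swap: "comm y x = - comm x y"
  by (simp add: comm_def)

lemma comm_sum_left: "comm (sum f A) w = (\<Sum>i\<in>A. comm (f i) w)"
  and comm_sum_right: "comm w (sum f A) = (\<Sum>i\<in>A. comm w (f i))"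
  by (simp_all add: comm_def sum_distrib_left sum_distrib_right sum_subtractf)

locale heisenberg =
  fixes n :: nat and sc :: "complex \<Rightarrow> 't::ring" and p :: "nat \<Rightarrow> 't" and z zi :: 't
  assumes sc_add: "sc (a + b) = sc a + sc b"
    and sc_mult: "sc (a * b) = sc a * sc b"
    and sc_p: "comm (sc a) (p k) = 0"
    and sc_zi: "comm (sc a) zi = 0"
    and one_p: "sc 1 * p k = p k"
    and sc_z: "comm (sc a) z = 0"
    and one_z: "sc 1 * z = z"
    and z_zi: "comm z zi = 0"
    and z_p: "comm z (p k) = 0"
    and zi_p: "comm zi (p k) = 0"
    and zi_z: "zi * z = sc 1"
    and p_p: "comm (p j) (p k) =
      (if j + k = 2*n+1 then sc ((-1) ^ (j + n + 1) * of_nat (fact j * fact (2*n+1-j))) * z else 0)"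
begin

definition N :: nat where "N = 2*n+1"

definition Ec :: "nat \<Rightarrow> complex" where
  "Ec k = (-1) ^ (k + n + 1) * (lc n - of_nat k) / (of_nat (fact (k - 1)) * of_nat (fact (N-k)))"
definition Fc :: "nat \<Rightarrow> complex" where
  "Fc k = (-1) ^ (k + n) * (lc n - of_nat k) / (of_nat (fact (k - 1)) * of_nat (fact (N-k)))"
definition Hc :: "nat \<Rightarrow> complex" where
  "Hc k = (-1) ^ (k + n) * (lc n - of_nat k) / (of_nat (fact k) * of_nat (fact (N-k)))"
text \<open>The structure constant c_k: \<open>comm (p k) (p (N - k))\<close> equals
  \<open>sc (pc k) * z\<close> for k \<le> N.\<close>

definition pc :: "nat \<Rightarrow> complex" where
  "pc k = (-1) ^ (k + n + 1) * of_nat (fact k * fact (N-k))"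

definition quad :: "complex \<Rightarrow> nat \<Rightarrow> nat \<Rightarrow> 't" where
  "quad a i j = zi * (sc a * (p i * p j))"

definition E :: 't where "E = (\<Sum>k\<in>{1..N}. quad (Ec k) (k - 1) (N - k))"
definition F :: 't where "F = (\<Sum>k\<in>{1..N}. quad (Fc k) k (N - k + 1))"
definition H :: 't where
  "H = (\<Sum>k\<in>{0..n}. quad (2 * Hc k) (N - k) k) - sc ((lc n + 1/2)^2 / 2)"

lemma sc_0 [simp]: "sc 0 = 0"
  using sc_add[of 0 0] by simp

lemma sc_minus: "sc (- a) = - sc a"
  using sc_add[of a "- a"] by (simp add: eq_neg_iff_add_eq_0 add.commute)

lemma sc_diff: "sc (a - b) = sc a - sc b"
  using sc_add[of a "- b"] by (simp add: sc_minus)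

lemma sc_sum: "sc (sum f A) = (\<Sum>i\<in>A. sc (f i))"
  by (induction A rule: infinite_finite_induct) (simp_all add: sc_add)

lemma sc_p': "sc a * p k = p k * sc a" "p k * sc a = sc a * p k"
  and sc_zi': "sc a * zi = zi * sc a"
  and z_p': "z * p k = p k * z"
  using sc_p[of a k] sc_zi[of a] z_p[of k] by (simp_all add: comm_def)

lemma comm_p: "comm (p j) (p k) = (if j + k = N then sc (pc j) * z else 0)"
  by (simp add: p_p pc_def N_def)

text \<open>The Leibniz rule gives two terms, and in each \<open>zi\<close> cancels the
  \<open>z\<close> coming from the bracket. The conditions sit inside the scalars so that a sum over
  k collapses to its single surviving index.\<close>

lemma quad_comm_p:
  "comm (quad a i j) (p m) =
     sc (a * (if j + m = N then pc j else 0)) * p i + sc (a * (if i + m = N then pc i else 0)) * p j"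
proof -
  have 1: "zi * (sc a * (x * (sc b * z))) = sc (a * b) * x"
    if "x = p k" for x b k
  proof -
    have "zi * (sc a * (x * (sc b * z))) = zi * (sc a * sc b * (x * z))"
      unfolding that by (simp add: mult.assoc) (metis mult.assoc sc_p'(1))
    also have "\<dots> = sc (a * b) * (zi * z * x)"
      unfolding that by (simp add: z_p'[symmetric] sc_mult) (metis mult.assoc sc_mult sc_zi')
    finally show ?thesis by (simp add: that zi_z one_p)
  qed
  have 2: "zi * (sc a * (sc b * z * x)) = sc (a * b) * x"
    if "x = p k" for x b k
    using 1[of x k b] that by (simp add: mult.assoc z_p') (metis mult.assoc sc_p'(1))
  have "comm (quad a i j) (p m) = zi * (sc a * (p i * comm (p j) (p m) + comm (p i) (p m) * p j))"
    unfolding quad_def by (simp add: comm_mult_left zi_p sc_p)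
  then show ?thesis
    by (simp add: comm_p distrib_left 1 2)
qed


section \<open>The coefficients in terms of the structure constants\<close>

lemma pc_nonzero [simp]: "pc k \<noteq> 0"
  by (simp add: pc_def)

text \<open>A sign is its own inverse and may move to the denominator. The factor \<open>K\<close>
  completes (k-1)! to k! in \<open>Ec_eq\<close> and is 1 in \<open>Hc_eq\<close>.\<close>

lemma sign_frac:
  fixes L K f g :: complex
  assumes "K \<noteq> 0"
  shows "(-1) ^ m * L / (f * g) = L * K / ((-1) ^ m * (K * f * g))"
  using assms by (cases "even m") (auto simp: divide_simps)

text \<open>This is antisymmetry of the bracket: \<open>N\<close> is odd, so k and N - k have
  opposite parity.\<close>

lemma pc_reflect: "k \<le> N \<Longrightarrow> pc (N - k) = - pc k"
proof -
  assume k: "k \<le> N"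
  then have "(-1::complex) ^ (N - k + n + 1) = - ((-1) ^ (k + n + 1))"
    by (auto simp: minus_one_power_iff N_def)
  with k show ?thesis by (simp add: pc_def mult.commute)
qed

text \<open>This is invariance of the bracket under f: applying f to [p_k, p_{N-k-1}] = 0 by the
  Leibniz rule gives (N-k) c_{k+1} + (k+1) c_k = 0.\<close>

lemma pc_Suc: "k < N \<Longrightarrow> of_nat (N - k) * pc (Suc k) = - of_nat (Suc k) * pc k"
proof -
  assume "k < N"
  then obtain m where m: "N - k = Suc m" "N - Suc k = m" by (metis Suc_diff_Suc)
  then show ?thesis unfolding pc_def m by (simp add: algebra_simps)
qed

lemma Ec_eq: "k \<ge> 1 \<Longrightarrow> Ec k = (lc n - of_nat k) * of_nat k / pc k"
proof -
  assume "k \<ge> 1"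
  then have "of_nat (fact k) = (of_nat k * of_nat (fact (k - 1)) :: complex)" "of_nat k \<noteq> (0::complex)"
    by (simp_all add: fact_reduce)
  then show ?thesis
    unfolding Ec_def pc_def of_nat_mult using sign_frac by metis
qed

lemma Fc_eq: "k \<ge> 1 \<Longrightarrow> Fc k = - (lc n - of_nat k) * of_nat k / pc k"
proof -
  assume "k \<ge> 1"
  moreover have "Fc k = - Ec k" by (simp add: Fc_def Ec_def)
  ultimately show ?thesis by (simp only: Ec_eq minus_divide_left mult_minus_left)
qed

lemma Hc_eq: "Hc k = - (lc n - of_nat k) / pc k"
  using sign_frac[of 1 "k + n + 1" "lc n - of_nat k" "of_nat (fact k)" "of_nat (fact (N - k))"]
  by (simp add: Hc_def pc_def) (metis minus_diff_eq minus_divide_left minus_minus)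

lemma ratio_pc_Suc:
  assumes "k < N"
  shows "of_nat (Suc k) / pc (Suc k) = - of_nat (N - k) / pc k"
proof -
  have "of_nat (Suc k) * pc k = - of_nat (N - k) * pc (Suc k)"
    using pc_Suc[OF assms] by (metis minus_equation_iff minus_mult_left)
  then show ?thesis by (subst frac_eq_eq) simp_all
qed

lemma Ec_Suc:
  assumes "k < N"
  shows "Ec (Suc k) = - (lc n - of_nat k - 1) * of_nat (N - k) / pc k"
proof -
  have "Ec (Suc k) = (lc n - of_nat (Suc k)) * (of_nat (Suc k) / pc (Suc k))"
    by (simp add: Ec_eq)
  also have "\<dots> = - (lc n - of_nat k - 1) * of_nat (N - k) / pc k"
    unfolding ratio_pc_Suc[OF assms] by (simp add: divide_simps) (simp add: algebra_simps)
  finally show ?thesis .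
qed

lemma Fc_Suc:
  assumes "k < N"
  shows "Fc (Suc k) = (lc n - of_nat k - 1) * of_nat (N - k) / pc k"
proof -
  have "Fc (Suc k) = - Ec (Suc k)" by (simp add: Fc_def Ec_def)
  then show ?thesis by (simp only: Ec_Suc[OF assms] minus_divide_left mult_minus_left minus_minus)
qed

lemma two_lc: "of_nat N = 2 * lc n"
  by (simp add: lc_def N_def)

text \<open>Only k = m survives in the first sum and k = N - m + 1 in the second. Their coefficients
  -(l-m)m and (l+1-m)m add up to m. For m = 0 both indices leave the range 1..N, and the truncated
  index \<open>m - 1\<close> is harmless because its coefficient is zero.\<close>

lemma E_p:
  assumes m: "m \<le> N"
  shows "comm E (p m) = sc (of_nat m) * p (m - 1)"
proof -
  have "comm E (p m) =
     (\<Sum>k\<in>{1..N}. sc (Ec k * (if N - k + m = N then pc (N - k) else 0)) * p (k - 1))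
   + (\<Sum>k\<in>{1..N}. sc (Ec k * (if k - 1 + m = N then pc (k - 1) else 0)) * p (N - k))"
    by (simp only: E_def comm_sum_left quad_comm_p sum.distrib)
  also have "(\<Sum>k\<in>{1..N}. sc (Ec k * (if N - k + m = N then pc (N - k) else 0)) * p (k - 1))
    = (\<Sum>k\<in>{1..N}. if k = m then sc (Ec m * pc (N - m)) * p (m - 1) else 0)"
    by (rule sum.cong) auto
  also have "\<dots> = sc (- ((lc n - of_nat m) * of_nat m)) * p (m - 1)"
    using m by (cases "m = 0") (auto simp: pc_reflect Ec_eq)
  also have "(\<Sum>k\<in>{1..N}. sc (Ec k * (if k - 1 + m = N then pc (k - 1) else 0)) * p (N - k))
    = (\<Sum>k\<in>{1..N}. if k = Suc (N - m) then sc (Ec (Suc (N - m)) * pc (N - m)) * p (m - 1) else 0)"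
    using m by (intro sum.cong) auto
  also have "\<dots> = sc ((lc n + 1 - of_nat m) * of_nat m) * p (m - 1)"
  proof (cases "m = 0")
    case False
    have "Ec (Suc (N - m)) * pc (N - m) = - (lc n - of_nat (N - m) - 1) * of_nat m"
      using False m by (subst Ec_Suc) auto
    also have "of_nat (N - m) = 2 * lc n - of_nat m"
      using m two_lc by (simp add: of_nat_diff)
    also have "- (lc n - (2 * lc n - of_nat m) - 1) = lc n + 1 - of_nat m"
      by simp
    finally show ?thesis using False m by auto
  qed auto
  finally show ?thesis
    by (simp only: distrib_right[symmetric] sc_add[symmetric]) (simp add: algebra_simps)
qed

text \<open>Here k = m + 1 and k = N - m survive, with coefficients -(l-m-1)(N-m) and (l-m)(N-m),
  whose sum is N - m. For m = N neither index lies in the range, and \<open>p (N + 1)\<close> occurs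
  with coefficient zero.\<close>

lemma F_p:
  assumes m: "m \<le> N"
  shows "comm F (p m) = sc (of_nat (N - m)) * p (m + 1)"
proof -
  have "comm F (p m) =
     (\<Sum>k\<in>{1..N}. sc (Fc k * (if N - k + 1 + m = N then pc (N - k + 1) else 0)) * p k)
   + (\<Sum>k\<in>{1..N}. sc (Fc k * (if k + m = N then pc k else 0)) * p (N - k + 1))"
    by (simp only: F_def comm_sum_left quad_comm_p sum.distrib)
  also have "(\<Sum>k\<in>{1..N}. sc (Fc k * (if N - k + 1 + m = N then pc (N - k + 1) else 0)) * p k)
    = (\<Sum>k\<in>{1..N}. if k = Suc m then sc (Fc (Suc m) * pc (N - m)) * p (m + 1) else 0)"
    by (rule sum.cong) (auto simp: Suc_diff_Suc)
  also have "\<dots> = sc (- ((lc n - of_nat m - 1) * of_nat (N - m))) * p (m + 1)"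
    using m by (cases "m = N") (auto simp: pc_reflect Fc_Suc)
  also have "(\<Sum>k\<in>{1..N}. sc (Fc k * (if k + m = N then pc k else 0)) * p (N - k + 1))
    = (\<Sum>k\<in>{1..N}. if k = N - m then sc (Fc (N - m) * pc (N - m)) * p (m + 1) else 0)"
    using m by (intro sum.cong) auto
  also have "\<dots> = sc ((lc n - of_nat m) * of_nat (N - m)) * p (m + 1)"
  proof (cases "m = N")
    case False
    have "Fc (N - m) * pc (N - m) = - (lc n - of_nat (N - m)) * of_nat (N - m)"
      using False m by (subst Fc_eq) auto
    also have "- (lc n - of_nat (N - m)) = lc n - of_nat m"
      using m two_lc by (simp add: of_nat_diff)
    finally show ?thesis using False m by auto
  qed auto
  finally show ?thesis
    by (simp only: distrib_right[symmetric] sc_add[symmetric]) (simp add: algebra_simps)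
qed

text \<open>As N = 2n + 1, exactly one of m and N - m is at most n; so one of the two sums gives the
  whole eigenvalue and the other is empty. The additive constant of \<open>H\<close> commutes with
  everything here.\<close>

lemma H_p:
  assumes m: "m \<le> N"
  shows "comm H (p m) = sc (2 * (lc n - of_nat m)) * p m"
proof -
  have "comm H (p m) =
     (\<Sum>k\<in>{0..n}. sc (2 * Hc k * (if k + m = N then pc k else 0)) * p (N - k))
   + (\<Sum>k\<in>{0..n}. sc (2 * Hc k * (if N - k + m = N then pc (N - k) else 0)) * p k)"
    unfolding H_def by (simp add: sc_p comm_diff_left comm_sum_left quad_comm_p sum.distrib)
  also have "(\<Sum>k\<in>{0..n}. sc (2 * Hc k * (if k + m = N then pc k else 0)) * p (N - k))
    = (\<Sum>k\<in>{0..n}. if k = N - m then sc (2 * Hc (N - m) * pc (N - m)) * p m else 0)"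
    using m by (intro sum.cong) auto
  also have "\<dots> = (if m > n then sc (2 * (lc n - of_nat m)) * p m else 0)"
    using m two_lc by (auto simp: Hc_eq of_nat_diff N_def)
  also have "(\<Sum>k\<in>{0..n}. sc (2 * Hc k * (if N - k + m = N then pc (N - k) else 0)) * p k)
    = (\<Sum>k\<in>{0..n}. if k = m then sc (2 * Hc m * pc (N - m)) * p m else 0)"
    using m by (intro sum.cong) (auto simp: N_def)
  also have "\<dots> = (if m \<le> n then sc (2 * (lc n - of_nat m)) * p m else 0)"
    using m by (auto simp: Hc_eq pc_reflect)
  finally show ?thesis by auto
qed

section \<open>The commutators among E, F and H\<close>

lemma comm_sc_sc: "comm (sc a) (sc b) = 0"
  by (simp add: comm_def sc_mult[symmetric] mult.commute)

lemma comm_quad_sc: "comm (quad a i j) (sc b) = 0"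
proof -
  have "comm (p i) (sc b) = 0" "comm (p j) (sc b) = 0" "comm zi (sc b) = 0"
    using sc_p sc_zi by (simp_all add: comm_def)
  then show ?thesis by (simp add: quad_def comm_mult_left comm_sc_sc)
qed

lemma comm_quad_zi: "comm (quad a i j) zi = 0"
proof -
  have "comm (p i) zi = 0" "comm (p j) zi = 0" "comm zi zi = 0"
    using zi_p by (simp_all add: comm_def)
  then show ?thesis by (simp add: quad_def comm_mult_left sc_zi)
qed

lemma quad_add: "quad (a + b) i j = quad a i j + quad b i j"
  by (simp add: quad_def sc_add algebra_simps)

lemma quad_0 [simp]: "quad 0 i j = 0"
  by (simp add: quad_def)

text \<open>Exchanging the factors costs \<open>sc (pc i) * z\<close>, which \<open>zi\<close> turns
  into a scalar. This is the source of the constant term of \<open>H\<close>.\<close>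

lemma quad_swap: "i + j = N \<Longrightarrow> quad a i j = quad a j i + sc (a * pc i)"
proof -
  assume "i + j = N"
  then have "p i * p j = p j * p i + sc (pc i) * z"
    using comm_p[of i j] by (simp add: comm_def algebra_simps)
  moreover have "zi * (sc a * (sc (pc i) * z)) = sc (a * pc i)"
  proof -
    have "zi * (sc a * (sc (pc i) * z)) = zi * sc (a * pc i) * z"
      by (simp add: sc_mult mult.assoc)
    also have "\<dots> = sc (a * pc i) * (zi * z)"
      by (simp add: sc_zi'[symmetric] mult.assoc)
    also have "\<dots> = sc (a * pc i * 1)" unfolding zi_z sc_mult ..
    finally show ?thesis by simp
  qed
  ultimately show ?thesis by (simp add: quad_def distrib_left)
qed

text \<open>\<open>comm D\<close> is a derivation; when it kills \<open>zi\<close> and the scalars,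
  it acts on the two factors \<open>p i\<close> and \<open>p j\<close> separately. It is applied
  with \<open>D\<close> equal to \<open>H\<close> and to \<open>E\<close>.\<close>

lemma derivation_quad:
  assumes "comm D zi = 0" "\<And>a. comm D (sc a) = 0"
    and "comm D (p i) = sc \<alpha> * p i'" "comm D (p j) = sc \<beta> * p j'"
  shows "comm D (quad a i j) = quad (a * \<alpha>) i' j + quad (a * \<beta>) i j'"
proof -
  have "comm D (quad a i j) = zi * (sc a * (p i * (sc \<beta> * p j') + sc \<alpha> * p i' * p j))"
    by (simp add: quad_def comm_mult_right assms)
  also have "p i * (sc \<beta> * p j') = sc \<beta> * (p i * p j')"
    by (metis mult.assoc sc_p'(1))
  finally show ?thesis by (simp add: quad_def distrib_left sc_mult mult.assoc add.commute)
qed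

lemma E_zi: "comm E zi = 0" and E_sc: "comm E (sc a) = 0"
  by (simp_all add: E_def comm_sum_left comm_quad_zi comm_quad_sc)

lemma H_zi: "comm H zi = 0" and H_sc: "comm H (sc a) = 0"
  by (simp_all add: H_def comm_diff_left comm_sum_left comm_quad_zi comm_quad_sc sc_zi comm_sc_sc)

lemma sc_zi_left: "sc b * (zi * x) = zi * (sc b * x)"
  by (metis mult.assoc sc_zi')

lemma sc_quad: "sc b * quad a i j = quad (b * a) i j"
  by (simp add: quad_def sc_zi_left sc_mult mult.assoc)

lemma H_E: "comm H E = sc 2 * E"
proof -
  have "comm H (quad (Ec k) (k - 1) (N - k)) = quad (2 * Ec k) (k - 1) (N - k)"
    if "k \<in> {1..N}" for k
  proof -
    have "comm H (quad (Ec k) (k - 1) (N - k))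
      = quad (Ec k * (2 * (lc n - of_nat (k - 1))) + Ec k * (2 * (lc n - of_nat (N - k)))) (k - 1) (N - k)"
      unfolding quad_add by (rule derivation_quad) (use that in \<open>auto simp only: H_zi H_sc atLeastAtMost_iff intro!: H_p\<close>)
    \<comment> \<open>The weights 2(l-k+1) and 2(k-l) of the two factors add up to 2, as N =
      2l.\<close>
    also have "Ec k * (2 * (lc n - of_nat (k - 1))) + Ec k * (2 * (lc n - of_nat (N - k))) = 2 * Ec k"
      using that two_lc by (simp add: of_nat_diff algebra_simps)
    finally show ?thesis .
  qed
  then show ?thesis by (simp add: E_def comm_sum_right sum_distrib_left sc_quad)
qed

lemma H_F: "comm H F = sc (-2) * F"
proof -
  have "comm H (quad (Fc k) k (N - k + 1)) = quad (-2 * Fc k) k (N - k + 1)"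
    if "k \<in> {1..N}" for k
  proof -
    have "comm H (quad (Fc k) k (N - k + 1))
      = quad (Fc k * (2 * (lc n - of_nat k)) + Fc k * (2 * (lc n - of_nat (N - k + 1)))) k (N - k + 1)"
      unfolding quad_add by (rule derivation_quad) (use that in \<open>auto simp only: H_zi H_sc atLeastAtMost_iff intro!: H_p\<close>)
    \<comment> \<open>Here the weights are 2(l-k) and 2(k-l-1), with sum -2.\<close>
    also have "Fc k * (2 * (lc n - of_nat k)) + Fc k * (2 * (lc n - of_nat (N - k + 1))) = -2 * Fc k"
      using that two_lc by (simp add: of_nat_diff algebra_simps)
    finally show ?thesis .
  qed
  then show ?thesis by (simp add: F_def comm_sum_right sum_distrib_left sc_quad)
qed

text \<open>The coefficient of p_j p_{N-j} / z in [E,F] before reordering. The first summand comes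
  from the term k = j + 1 of \<open>F\<close>, whose left factor is lowered by \<open>E\<close>; the
  second from k = j, whose right factor is lowered.\<close>

definition EFc :: "nat \<Rightarrow> complex" where
  "EFc j = ((lc n - of_nat j - 1) * of_nat (N - j) * of_nat (j + 1)
            - (lc n - of_nat j) * of_nat j * of_nat (N - j + 1)) / pc j"

text \<open>Multiplication by \<open>pc j\<close> clears the denominator and leaves a quadratic
  polynomial in j, which has a closed summation formula.\<close>

lemma EF_const: "(\<Sum>j=0..n. EFc j * pc j) = - ((lc n + 1/2)^2 / 2)"
proof -
  let ?l = "lc n"
  \<comment> \<open>The upper bound m varies while l stays fixed, so that the induction goes
    through; m = n + 1 and l = n + 1/2 are inserted afterwards.\<close>
  have S: "(\<Sum>j<m. 3 * of_nat j ^ 2 - (6 * ?l - 1) * of_nat j + 2 * ?l^2 - 2 * ?l) =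
      of_nat m * ((of_nat m - 1) * (2 * of_nat m - 6 * ?l) + 4 * ?l^2 - 4 * ?l) / 2" for m
    by (induction m) (simp_all add: field_simps power2_eq_square)
  have "(\<Sum>j=0..n. EFc j * pc j) = (\<Sum>j<Suc n. 3 * of_nat j ^ 2 - (6 * ?l - 1) * of_nat j + 2 * ?l^2 - 2 * ?l)"
  proof (rule sum.cong)
    fix j assume "j \<in> {..<Suc n}"
    then have r: "of_nat (N - j) = 2 * ?l - of_nat j"
      by (simp add: of_nat_diff N_def lc_def)
    have "EFc j * pc j = (?l - of_nat j - 1) * of_nat (N - j) * of_nat (j + 1)
            - (?l - of_nat j) * of_nat j * of_nat (N - j + 1)"
      by (simp add: EFc_def)
    then show "EFc j * pc j = 3 * of_nat j ^ 2 - (6 * ?l - 1) * of_nat j + 2 * ?l^2 - 2 * ?l"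
      by (simp add: r algebra_simps power2_eq_square)
  qed auto
  also have "\<dots> = - ((?l + 1/2)^2 / 2)"
    unfolding S by (simp add: lc_def power2_eq_square algebra_simps)
  finally show ?thesis .
qed

lemma E_F: "comm E F = H"
proof -
  have "comm E F = (\<Sum>k=1..N. comm E (quad (Fc k) k (N - k + 1)))"
    by (simp add: F_def comm_sum_right)
  also have "\<dots> = (\<Sum>k=1..N. quad (Fc k * of_nat k) (k - 1) (N - k + 1)
                         + quad (Fc k * of_nat (N - k + 1)) k (N - k + 1 - 1))"
    by (intro sum.cong refl derivation_quad E_zi E_sc E_p) auto
  also have "\<dots> = (\<Sum>k=1..N. quad (Fc k * of_nat k) (k - 1) (N - k + 1))
                 + (\<Sum>k=1..N. quad (Fc k * of_nat (N - k + 1)) k (N - k))"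
    by (simp add: sum.distrib)
  also have "(\<Sum>k=1..N. quad (Fc k * of_nat k) (k - 1) (N - k + 1))
      = (\<Sum>j=0..<N. quad (Fc (Suc j) * of_nat (Suc j)) j (N - j))"
    by (rule sum.reindex_bij_witness[of _ Suc "\<lambda>k. k - 1"]) (auto simp: Suc_diff_le)
  \<comment> \<open>Both sums are brought to the range 0..N: the added term j = N vanishes by the
    factor N - j, and in the second sum the added term j = 0 vanishes by the factor j.\<close>
  also have "\<dots> = (\<Sum>j=0..N. quad ((lc n - of_nat j - 1) * of_nat (N - j) * of_nat (j + 1) / pc j) j (N - j))"
    by (rule sum.mono_neutral_cong_left) (auto simp: Fc_Suc)
  also have "(\<Sum>k=1..N. quad (Fc k * of_nat (N - k + 1)) k (N - k))
    = (\<Sum>j=0..N. quad (- ((lc n - of_nat j) * of_nat j * of_nat (N - j + 1) / pc j)) j (N - j))"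
  proof (rule sum.mono_neutral_cong_left)
    show "quad (Fc k * of_nat (N - k + 1)) k (N - k)
      = quad (- ((lc n - of_nat k) * of_nat k * of_nat (N - k + 1) / pc k)) k (N - k)" if "k \<in> {1..N}" for k
    proof -
      have "Fc k * of_nat (N - k + 1) = - ((lc n - of_nat k) * of_nat k * of_nat (N - k + 1) / pc k)"
        using that by (subst Fc_eq) (auto simp only: atLeastAtMost_iff times_divide_eq_left mult_minus_left minus_divide_left)
      then show ?thesis by (rule arg_cong)
    qed
  qed (auto simp: not_less_eq_eq)
  finally have "comm E F = (\<Sum>j=0..N. quad (EFc j) j (N - j))"
    by (simp add: sum.distrib[symmetric] quad_add[symmetric] EFc_def diff_divide_distrib)
  \<comment> \<open>The reflection j to N - j exchanges the two halves and, N being odd, has no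
    fixed point. The lower half is reordered by \<open>quad_swap\<close>, the upper half is
    reindexed.\<close>
  also have "\<dots> = (\<Sum>j\<in>{0..n} \<union> {n+1..N}. quad (EFc j) j (N - j))"
    by (rule sum.cong) (auto simp: N_def)
  also have "\<dots> = (\<Sum>j=0..n. quad (EFc j) j (N - j)) + (\<Sum>j=n+1..N. quad (EFc j) j (N - j))"
    by (rule sum.union_disjoint) auto
  also have "(\<Sum>j=0..n. quad (EFc j) j (N - j))
    = (\<Sum>j=0..n. quad (EFc j) (N - j) j) + sc (\<Sum>j=0..n. EFc j * pc j)"
    unfolding sc_sum sum.distrib[symmetric] by (intro sum.cong refl quad_swap) (auto simp: N_def)
  also have "(\<Sum>j=n+1..N. quad (EFc j) j (N - j)) = (\<Sum>j=0..n. quad (EFc (N - j)) (N - j) j)"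
    by (rule sum.reindex_bij_witness[of _ "\<lambda>j. N - j" "\<lambda>j. N - j"]) (auto simp: N_def)
  finally have "comm E F = (\<Sum>j=0..n. quad (EFc j + EFc (N - j)) (N - j) j) + sc (\<Sum>j=0..n. EFc j * pc j)"
    by (simp add: quad_add sum.distrib)
  also have "(\<Sum>j=0..n. quad (EFc j + EFc (N - j)) (N - j) j) = (\<Sum>j=0..n. quad (2 * Hc j) (N - j) j)"
  proof (intro sum.cong refl, goal_cases)
    case (1 j)
    then have j: "j \<le> N" by (auto simp: N_def)
    have r: "of_nat (N - j) = 2 * lc n - of_nat j" using j two_lc by (simp add: of_nat_diff)
    \<comment> \<open>Reflection changes the sign of \<open>pc j\<close>, so the numerators are
      subtracted. The cubic and quadratic parts cancel and leave -2(l-j).\<close>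
    have "EFc j + EFc (N - j) = 2 * Hc j"
      using j unfolding EFc_def Hc_eq pc_reflect[OF j]
      by (simp add: r of_nat_diff) (simp add: field_simps)
    then show ?case by simp
  qed
  finally show ?thesis by (simp add: EF_const H_def sc_minus)
qed

section \<open>Evaluation of all brackets of generators\<close>

lemma F_sc: "comm F (sc a) = 0"
  by (simp add: F_def comm_sum_left comm_quad_sc)

lemma z_sc: "comm z (sc a) = 0"
  using sc_z[of a] by (simp add: comm_def)

lemma z_quad: "comm z (quad a i j) = 0"
  by (simp add: quad_def comm_mult_right z_zi z_p z_sc)

lemma z_E: "comm z E = 0" and z_F: "comm z F = 0" and z_H: "comm z H = 0"
  by (simp_all add: E_def F_def H_def comm_sum_right comm_diff_right z_quad z_sc)

lemma one_E: "sc 1 * E = E" and one_F: "sc 1 * F = F" and one_H: "sc 1 * H = H"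
  by (simp_all add: E_def F_def H_def sum_distrib_left right_diff_distrib sc_quad sc_mult[symmetric])

definition image_gen :: "gen \<Rightarrow> 't" where
  "image_gen x = (case x of GE \<Rightarrow> E | GH \<Rightarrow> H | GF \<Rightarrow> F | GP k \<Rightarrow> p k | GZ \<Rightarrow> z)"

lemma image_gen_simps [simp]:
  "image_gen GE = E" "image_gen GH = H" "image_gen GF = F" "image_gen (GP k) = p k" "image_gen GZ = z"
  by (simp_all add: image_gen_def)

lemma comm_image_gen_sc: "comm (image_gen x) (sc a) = 0"
  using sc_p'(2)[of _ a] by (cases x) (simp_all add: E_sc F_sc H_sc z_sc, simp add: comm_def)

sublocale ev: evaluation sc image_gen
proof
  show "sc a * image_gen x = image_gen x * sc a" for a x
    using comm_image_gen_sc[of x a] by (simp add: comm_def)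
  show "sc 1 * image_gen x = image_gen x" for x
    by (cases x) (auto simp: one_E one_F one_H one_p one_z)
qed (rule sc_add sc_mult)+

lemma ev_smult_gen: "ev.ev (fa_smult c (fa_gen x)) = sc c * image_gen x"
proof -
  have "finite {w :: gen list. fa_scal c w \<noteq> 0}" "finite {w. fa_gen x w \<noteq> 0}"
    by (auto simp: fa_scal_def fa_gen_def)
  then have "ev.ev (fa_mult (fa_scal c) (fa_gen x)) = sc c * image_gen x"
    by (simp only: ev.ev_mult ev.ev_scal ev.ev_gen)
  then show ?thesis by (simp add: fa_scal_mult)
qed

lemma ev_zero: "ev.ev (\<lambda>w. 0) = 0"
  by (simp add: ev.ev_def)

lemma comm_self: "comm x x = 0"
  by (simp add: comm_def)

lemma comm_image_gen:
  assumes "x \<in> gens_g n" "y \<in> gens_g n"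
  shows "comm (image_gen x) (image_gen y) = ev.ev (br n x y)"
proof -
  \<comment> \<open>Antisymmetry is instantiated in one direction for each pair: this reduces to the
    commutators already computed and keeps the simplifier from looping.\<close>
  note swap = comm_swap[of "p _" E] comm_swap[of "p _" F] comm_swap[of "p _" H]
    comm_swap[of E H] comm_swap[of F H] comm_swap[of F E]
    comm_swap[of E z] comm_swap[of F z] comm_swap[of H z] comm_swap[of "p _" z]
  show ?thesis
    using assms
    by (cases x; cases y)
       (auto simp: gens_g_def N_def ev_smult_gen ev_zero ev.ev_gen swap E_p F_p H_p E_F H_E H_F z_E z_F z_H z_p
          comm_self p_p sc_minus sc_diff left_diff_distrib one_H of_nat_diff)
qed

lemma ev_diff:
  assumes "f \<in> carrier (free_alg S)" "g \<in> carrier (free_alg S)"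
  shows "ev.ev (\<lambda>w. f w - g w) = ev.ev f - ev.ev g"
  using ev.ev_add[of "\<lambda>w. f w - g w" g] fa_diff_closed[OF assms] assms by (simp add: eq_diff_eq mem_free_alg)

end

section \<open>Localization at a central element\<close>

locale central_element = Ring.ring R for R :: "('a, 'b) ring_scheme" (structure) +
  fixes s assumes s_closed: "s \<in> carrier R"
    and s_comm: "x \<in> carrier R \<Longrightarrow> s \<otimes> x = x \<otimes> s"
begin

abbreviation "L \<equiv> localization R s"

lemma pow_closed [simp]: "s [^] (k::nat) \<in> carrier R"
  using s_closed by simp

lemma pow_comm: "x \<in> carrier R \<Longrightarrow> x \<otimes> s [^] (k::nat) = s [^] k \<otimes> x"
proof (induction k)
  case (Suc k)
  then have "x \<otimes> s [^] Suc k = s [^] k \<otimes> (x \<otimes> s)"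
    using s_closed by (simp add: m_assoc[symmetric])
  then show ?case
    using Suc.prems s_closed s_comm[OF Suc.prems] by (simp add: m_assoc)
qed simp

lemma pow_add: "s [^] (i + j) = s [^] i \<otimes> s [^] (j::nat)"
  using s_closed by (simp add: nat_pow_mult)

lemma pow_add_left: "x \<in> carrier R \<Longrightarrow> s [^] i \<otimes> (s [^] j \<otimes> x) = s [^] (i + j :: nat) \<otimes> x"
  by (simp add: pow_add m_assoc)

lemma pow_shift:
  assumes "a \<in> carrier R" "b \<in> carrier R" "s [^] (i::nat) \<otimes> a = s [^] (j::nat) \<otimes> b"
  shows "s [^] (t + i) \<otimes> a = s [^] (t + j) \<otimes> b"
  using assms pow_add_left by metis

lemma loc_rel_iff:
  "((a, i), (b, j)) \<in> loc_rel R s \<longleftrightarrow> a \<in> carrier R \<and> b \<in> carrier R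
     \<and> (\<exists>k. s [^] (j + k) \<otimes> a = s [^] (i + k) \<otimes> b)"
  by (simp add: loc_rel_def)

lemma equiv_loc_rel: "equiv (carrier R \<times> UNIV) (loc_rel R s)"
proof (rule equivI)
  show "loc_rel R s \<subseteq> (carrier R \<times> UNIV) \<times> (carrier R \<times> UNIV)"
    by (auto simp: loc_rel_def)
  show "refl_on (carrier R \<times> UNIV) (loc_rel R s)"
    by (auto simp: refl_on_def loc_rel_def)
  show "sym (loc_rel R s)"
    by (auto simp: sym_def loc_rel_def) metis
  show "trans (loc_rel R s)"
  proof (rule transI; clarify)
    fix a i b j c m
    assume "((a, i), (b, j)) \<in> loc_rel R s" "((b, j), (c, m)) \<in> loc_rel R s"
    then obtain k k' where c: "a \<in> carrier R" "b \<in> carrier R" "c \<in> carrier R"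
      and k: "s [^] (j + k) \<otimes> a = s [^] (i + k) \<otimes> b" "s [^] (m + k') \<otimes> b = s [^] (j + k') \<otimes> c"
      by (auto simp: loc_rel_iff)
    \<comment> \<open>The middle denominator s^j cannot be cancelled, as \<open>s\<close> may be a
      zero divisor, and is absorbed into the witness.\<close>
    have "s [^] (m + (k + j + k')) \<otimes> a = s [^] (i + (k + j + k')) \<otimes> c"
      using pow_shift[OF c(1,2) k(1), of "m + k'"] pow_shift[OF c(2,3) k(2), of "i + k"]
      by (simp add: ac_simps)
    then show "((a, i), (c, m)) \<in> loc_rel R s"
      using c by (auto simp: loc_rel_iff)
  qed
qed

lemma frac_eq_iff:
  assumes "a \<in> carrier R" "b \<in> carrier R"
  shows "frac R s a i = frac R s b j \<longleftrightarrow> (\<exists>k. s [^] (j + k) \<otimes> a = s [^] (i + k) \<otimes> b)"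
  unfolding frac_def using eq_equiv_class_iff[OF equiv_loc_rel, of "(a, i)" "(b, j)"] assms
  by (simp add: loc_rel_iff)

lemma frac_expand: "a \<in> carrier R \<Longrightarrow> frac R s a i = frac R s (s [^] k \<otimes> a) (k + i)"
  by (subst frac_eq_iff) (auto simp: pow_add_left add.commute intro!: exI[of _ 0])

lemma frac_closed: "a \<in> carrier R \<Longrightarrow> frac R s a i \<in> carrier L"
  by (auto simp: frac_def localization_def quotient_def)

lemma frac_cases:
  assumes "X \<in> carrier L" obtains a i where "a \<in> carrier R" "X = frac R s a i"
  using assms by (auto simp: frac_def localization_def quotient_def)

lemma mem_frac:
  assumes "a \<in> carrier R" "(b, j) \<in> frac R s a i"
  shows "b \<in> carrier R" "frac R s b j = frac R s a i"
proof -
  have r: "((a, i), (b, j)) \<in> loc_rel R s" using assms by (simp add: frac_def)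
  then show "b \<in> carrier R" by (simp add: loc_rel_iff)
  show "frac R s b j = frac R s a i"
    unfolding frac_def using equiv_class_eq[OF equiv_loc_rel r] by simp
qed

text \<open>The operations of \<open>localization\<close> are unions over all representatives. If
  the value does not depend on them, the union of equal nonempty index families collapses to that
  value.\<close>

lemma frac_UN:
  assumes a: "a \<in> carrier R" "b \<in> carrier R"
    and G: "\<And>a' i' b' j'. \<lbrakk>a' \<in> carrier R; b' \<in> carrier R; frac R s a' i' = frac R s a i;
      frac R s b' j' = frac R s b j\<rbrakk> \<Longrightarrow> G a' i' b' j' = G a i b j"
  shows "(\<Union>(a, i)\<in>frac R s a i. \<Union>(b, j)\<in>frac R s b j. G a i b j) = G a i b j"
proof -
  have ne: "(c, k) \<in> frac R s c k" if "c \<in> carrier R" for c k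
    using that by (simp add: frac_def loc_rel_iff)
  have "G (fst x) (snd x) (fst y) (snd y) = G a i b j" if "x \<in> frac R s a i" "y \<in> frac R s b j" for x y
    using that mem_frac[of a "fst x" "snd x" i] mem_frac[of b "fst y" "snd y" j] a by (intro G) auto
  then show ?thesis
    using ne[OF a(1), of i] ne[OF a(2), of j] by (auto simp: case_prod_unfold)
qed

lemma mult_frac:
  assumes "a \<in> carrier R" "b \<in> carrier R"
  shows "frac R s a i \<otimes>\<^bsub>L\<^esub> frac R s b j = frac R s (a \<otimes> b) (i + j)"
proof -
  have "frac R s (a' \<otimes> b') (i' + j') = frac R s (a \<otimes> b) (i + j)"
    if c: "a' \<in> carrier R" "b' \<in> carrier R"
      and f: "frac R s a' i' = frac R s a i" "frac R s b' j' = frac R s b j" for a' b' i' j'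
  proof -
    obtain k m where k: "s [^] (i + k) \<otimes> a' = s [^] (i' + k) \<otimes> a" "s [^] (j + m) \<otimes> b' = s [^] (j' + m) \<otimes> b"
      using f unfolding frac_eq_iff[OF c(1) assms(1)] frac_eq_iff[OF c(2) assms(2)] by blast
    \<comment> \<open>Centrality of \<open>s\<close> enters here: a power of \<open>s\<close> is
      moved past \<open>u\<close> to the second factor.\<close>
    have pm: "s [^] (x + y) \<otimes> (u \<otimes> v) = (s [^] x \<otimes> u) \<otimes> (s [^] y \<otimes> v)"
      if "u \<in> carrier R" "v \<in> carrier R" for x y :: nat and u v
    proof -
      have "(s [^] x \<otimes> u) \<otimes> (s [^] y \<otimes> v) = s [^] x \<otimes> (u \<otimes> s [^] y) \<otimes> v"
        using that by (simp add: m_assoc)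
      then show ?thesis using that by (simp add: pow_comm[of u] pow_add m_assoc)
    qed
    have e: "i + j + (k + m) = (i + k) + (j + m)" "i' + j' + (k + m) = (i' + k) + (j' + m)"
      by simp_all
    have "s [^] (i + j + (k + m)) \<otimes> (a' \<otimes> b') = s [^] (i' + j' + (k + m)) \<otimes> (a \<otimes> b)"
      unfolding e pm[OF c] pm[OF assms] k ..
    then show ?thesis using c assms by (subst frac_eq_iff) auto
  qed
  then have "(\<Union>(a, i)\<in>frac R s a i. \<Union>(b, j)\<in>frac R s b j. frac R s (a \<otimes> b) (i + j)) = frac R s (a \<otimes> b) (i + j)"
    by (intro frac_UN assms)
  then show ?thesis by (simp add: localization_def)
qed

lemma add_frac:
  assumes "a \<in> carrier R" "b \<in> carrier R"
  shows "frac R s a i \<oplus>\<^bsub>L\<^esub> frac R s b j = frac R s (s [^] j \<otimes> a \<oplus> s [^] i \<otimes> b) (i + j)"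
proof -
  have "frac R s (s [^] j' \<otimes> a' \<oplus> s [^] i' \<otimes> b') (i' + j') = frac R s (s [^] j \<otimes> a \<oplus> s [^] i \<otimes> b) (i + j)"
    if c: "a' \<in> carrier R" "b' \<in> carrier R"
      and f: "frac R s a' i' = frac R s a i" "frac R s b' j' = frac R s b j" for a' b' i' j'
  proof -
    obtain k m where k: "s [^] (i + k) \<otimes> a' = s [^] (i' + k) \<otimes> a" "s [^] (j + m) \<otimes> b' = s [^] (j' + m) \<otimes> b"
      using f unfolding frac_eq_iff[OF c(1) assms(1)] frac_eq_iff[OF c(2) assms(2)] by blast
    \<comment> \<open>The total exponents are regrouped so that each summand is a shifted instance
      of its own relation in \<open>k\<close>.\<close>
    have e: "i + j + (k + m) + j' = j + m + j' + (i + k)" "i' + j' + (k + m) + j = j + m + j' + (i' + k)"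
      "i + j + (k + m) + i' = i + k + i' + (j + m)" "i' + j' + (k + m) + i = i + k + i' + (j' + m)"
      by simp_all
    have d: "s [^] t \<otimes> (s [^] x \<otimes> u \<oplus> s [^] y \<otimes> v) = s [^] (t + x) \<otimes> u \<oplus> s [^] (t + y) \<otimes> v"
      if "u \<in> carrier R" "v \<in> carrier R" for t x y :: nat and u v
      using that by (simp add: r_distr pow_add_left)
    have "s [^] (i + j + (k + m)) \<otimes> (s [^] j' \<otimes> a' \<oplus> s [^] i' \<otimes> b')
       = s [^] (i' + j' + (k + m)) \<otimes> (s [^] j \<otimes> a \<oplus> s [^] i \<otimes> b)"
      unfolding d[OF c] d[OF assms] e
      using pow_shift[OF c(1) assms(1) k(1), of "j + m + j'"] pow_shift[OF c(2) assms(2) k(2), of "i + k + i'"]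
      by simp
    then show ?thesis using c assms by (subst frac_eq_iff) auto
  qed
  then have "(\<Union>(a, i)\<in>frac R s a i. \<Union>(b, j)\<in>frac R s b j.
      frac R s (s [^] j \<otimes> a \<oplus> s [^] i \<otimes> b) (i + j)) = frac R s (s [^] j \<otimes> a \<oplus> s [^] i \<otimes> b) (i + j)"
    by (intro frac_UN assms)
  then show ?thesis by (simp add: localization_def)
qed

lemma add_frac_same:
  assumes "a \<in> carrier R" "b \<in> carrier R"
  shows "frac R s a i \<oplus>\<^bsub>L\<^esub> frac R s b i = frac R s (a \<oplus> b) i"
  using assms by (simp add: add_frac r_distr[symmetric] frac_expand[symmetric])

text \<open>Over a common denominator, addition is addition of numerators; the additive axioms and
  distributivity thus reduce to those of \<open>R\<close>.\<close>

lemma common_denominator: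
  assumes "X \<in> carrier L" "Y \<in> carrier L"
  obtains a b i where "a \<in> carrier R" "b \<in> carrier R" "X = frac R s a i" "Y = frac R s b i"
proof -
  from assms obtain a b i j where c: "a \<in> carrier R" "b \<in> carrier R" "X = frac R s a i" "Y = frac R s b j"
    by (metis frac_cases)
  show ?thesis
    using that[of "s [^] j \<otimes> a" "s [^] i \<otimes> b" "j + i"] c frac_expand[of a i j] frac_expand[of b j i]
    by (simp add: add.commute)
qed

lemma common_denominator3:
  assumes "X \<in> carrier L" "Y \<in> carrier L" "Z \<in> carrier L"
  obtains a b c i where "a \<in> carrier R" "b \<in> carrier R" "c \<in> carrier R"
    "X = frac R s a i" "Y = frac R s b i" "Z = frac R s c i"
proof -
  obtain a b i where c: "a \<in> carrier R" "b \<in> carrier R" "X = frac R s a i" "Y = frac R s b i"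
    using common_denominator assms(1,2) by metis
  obtain c j where c': "c \<in> carrier R" "Z = frac R s c j"
    using frac_cases assms(3) by metis
  show ?thesis
    using that[of "s [^] j \<otimes> a" "s [^] j \<otimes> b" "s [^] i \<otimes> c" "j + i"] c c'
      frac_expand[of a i j] frac_expand[of b i j] frac_expand[of c j i]
    by (simp add: add.commute)
qed

lemma zero_frac: "\<zero>\<^bsub>L\<^esub> = frac R s \<zero> i"
proof -
  have "\<zero>\<^bsub>L\<^esub> = frac R s \<zero> 0" by (simp add: localization_def)
  then show ?thesis by (simp add: frac_eq_iff)
qed

lemma one_frac: "\<one>\<^bsub>L\<^esub> = frac R s \<one> 0"
  by (simp add: localization_def)

lemma ring_localization: "Ring.ring L"
proof (rule ringI)
  show "abelian_group L"
  proof (rule abelian_groupI)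
    fix X Y assume XY: "X \<in> carrier L" "Y \<in> carrier L"
    show "X \<oplus>\<^bsub>L\<^esub> Y \<in> carrier L"
      by (rule common_denominator[OF XY]) (simp add: add_frac_same frac_closed)
    show "X \<oplus>\<^bsub>L\<^esub> Y = Y \<oplus>\<^bsub>L\<^esub> X"
      by (rule common_denominator[OF XY]) (simp add: add_frac_same a_comm)
  next
    fix X Y Z assume XYZ: "X \<in> carrier L" "Y \<in> carrier L" "Z \<in> carrier L"
    show "X \<oplus>\<^bsub>L\<^esub> Y \<oplus>\<^bsub>L\<^esub> Z = X \<oplus>\<^bsub>L\<^esub> (Y \<oplus>\<^bsub>L\<^esub> Z)"
      by (rule common_denominator3[OF XYZ]) (simp add: add_frac_same a_assoc)
  next
    show "\<zero>\<^bsub>L\<^esub> \<in> carrier L" by (simp add: zero_frac[of 0] frac_closed)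
  next
    fix X assume "X \<in> carrier L"
    then obtain a i where a: "a \<in> carrier R" "X = frac R s a i" by (rule frac_cases)
    then show "\<zero>\<^bsub>L\<^esub> \<oplus>\<^bsub>L\<^esub> X = X"
      by (simp add: zero_frac[of i] add_frac_same)
    from a show "\<exists>Y\<in>carrier L. Y \<oplus>\<^bsub>L\<^esub> X = \<zero>\<^bsub>L\<^esub>"
      by (intro bexI[of _ "frac R s (\<ominus> a) i"]) (simp_all add: zero_frac[of i] add_frac_same l_neg frac_closed)
  qed
  show "monoid L"
  proof (rule monoidI)
    fix X Y assume "X \<in> carrier L" "Y \<in> carrier L"
    then show "X \<otimes>\<^bsub>L\<^esub> Y \<in> carrier L"
      by (elim frac_cases) (simp add: mult_frac frac_closed)
  next
    fix X Y Z assume "X \<in> carrier L" "Y \<in> carrier L" "Z \<in> carrier L"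
    then show "X \<otimes>\<^bsub>L\<^esub> Y \<otimes>\<^bsub>L\<^esub> Z = X \<otimes>\<^bsub>L\<^esub> (Y \<otimes>\<^bsub>L\<^esub> Z)"
      by (elim frac_cases) (simp add: mult_frac m_assoc add.assoc)
  qed (auto elim!: frac_cases simp: one_frac frac_closed mult_frac)
next
  fix X Y Z assume XYZ: "X \<in> carrier L" "Y \<in> carrier L" "Z \<in> carrier L"
  show "(X \<oplus>\<^bsub>L\<^esub> Y) \<otimes>\<^bsub>L\<^esub> Z = X \<otimes>\<^bsub>L\<^esub> Z \<oplus>\<^bsub>L\<^esub> Y \<otimes>\<^bsub>L\<^esub> Z"
    by (rule common_denominator3[OF XYZ]) (simp add: mult_frac add_frac_same l_distr)
  show "Z \<otimes>\<^bsub>L\<^esub> (X \<oplus>\<^bsub>L\<^esub> Y) = Z \<otimes>\<^bsub>L\<^esub> X \<oplus>\<^bsub>L\<^esub> Z \<otimes>\<^bsub>L\<^esub> Y"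
    by (rule common_denominator3[OF XYZ]) (simp add: mult_frac add_frac_same r_distr)
qed

lemma frac_0_hom: "(\<lambda>a. frac R s a 0) \<in> ring_hom R L"
  by (rule ring_hom_memI) (auto simp: frac_closed mult_frac add_frac_same one_frac)

lemma frac_inverse: "frac R s \<one> 1 \<otimes>\<^bsub>L\<^esub> frac R s s 0 = \<one>\<^bsub>L\<^esub>"
  using s_closed frac_expand[of \<one> 0 1] by (simp add: mult_frac one_frac)

lemma frac_inverse_comm:
  "a \<in> carrier R \<Longrightarrow> frac R s \<one> 1 \<otimes>\<^bsub>L\<^esub> frac R s a 0 = frac R s a 0 \<otimes>\<^bsub>L\<^esub> frac R s \<one> 1"
  by (simp add: mult_frac)

end

text \<open>The universal property of a quotient ring. \<Phi> evaluates \<phi> at a chosen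
  representative, which is legitimate because \<phi> is constant on cosets of
  \<open>I\<close>.\<close>

lemma quot_factor:
  assumes "ideal I R" "Ring.ring T" "\<phi> \<in> ring_hom R T" "\<And>x. x \<in> I \<Longrightarrow> \<phi> x = \<zero>\<^bsub>T\<^esub>"
  obtains \<Phi> where "\<Phi> \<in> ring_hom (R Quot I) T" "\<And>a. a \<in> carrier R \<Longrightarrow> \<Phi> (I +>\<^bsub>R\<^esub> a) = \<phi> a"
proof -
  interpret ideal I R by fact
  interpret T: Ring.ring T by fact
  interpret \<phi>: ring_hom_ring R T \<phi>
    by (intro ring_hom_ringI2 assms ring_axioms)
  have eq: "\<phi> a = \<phi> b" if "a \<in> carrier R" "b \<in> carrier R" "I +>\<^bsub>R\<^esub> a = I +>\<^bsub>R\<^esub> b" for a b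
  proof -
    have "a \<in> I +>\<^bsub>R\<^esub> b" using a_rcos_self[OF that(1)] that(3) by simp
    then obtain i where "i \<in> I" "a = i \<oplus>\<^bsub>R\<^esub> b"
      by (auto simp: a_r_coset_def')
    then show ?thesis using that assms(4)[of i] a_subset \<phi>.hom_add[of i b] by (auto simp: subset_iff)
  qed
  define \<Phi> where "\<Phi> X = \<phi> (SOME a. a \<in> carrier R \<and> I +>\<^bsub>R\<^esub> a = X)" for X
  have \<Phi>: "\<Phi> (I +>\<^bsub>R\<^esub> a) = \<phi> a" if "a \<in> carrier R" for a
  proof -
    have "\<exists>b. b \<in> carrier R \<and> I +>\<^bsub>R\<^esub> b = I +>\<^bsub>R\<^esub> a" using that by blast
    from someI_ex[OF this] show ?thesis unfolding \<Phi>_def using that by (intro eq) blast+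
  qed
  note h = rcos_ring_hom
  have "\<Phi> \<in> ring_hom (R Quot I) T"
  proof (rule ring_hom_memI)
    have rep: "\<exists>a\<in>carrier R. X = I +>\<^bsub>R\<^esub> a" if "X \<in> carrier (R Quot I)" for X
      using that by (auto simp: FactRing_def A_RCOSETS_def')
    {
      fix X assume "X \<in> carrier (R Quot I)"
      then show "\<Phi> X \<in> carrier T" using rep \<Phi> by fastforce
    next
      fix X Y assume "X \<in> carrier (R Quot I)" "Y \<in> carrier (R Quot I)"
      then obtain a b where ab: "a \<in> carrier R" "X = I +>\<^bsub>R\<^esub> a" "b \<in> carrier R" "Y = I +>\<^bsub>R\<^esub> b"
        using rep by metis
      show "\<Phi> (X \<otimes>\<^bsub>R Quot I\<^esub> Y) = \<Phi> X \<otimes>\<^bsub>T\<^esub> \<Phi> Y"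
        using ab ring_hom_mult[OF h, of a b] \<Phi> by (metis \<phi>.hom_mult m_closed)
      show "\<Phi> (X \<oplus>\<^bsub>R Quot I\<^esub> Y) = \<Phi> X \<oplus>\<^bsub>T\<^esub> \<Phi> Y"
        using ab ring_hom_add[OF h, of a b] \<Phi> by (metis \<phi>.hom_add a_closed)
    }
    show "\<Phi> \<one>\<^bsub>R Quot I\<^esub> = \<one>\<^bsub>T\<^esub>"
      using ring_hom_one[OF h] \<Phi>[of "\<one>\<^bsub>R\<^esub>"] by simp
  qed
  then show ?thesis using \<Phi> that by blast
qed

section \<open>The enveloping algebras and the homomorphism\<close>

text \<open>The assumption says that the bracket does not lead out of \<open>S\<close>; it covers
  both the full Lie algebra and its Heisenberg subalgebra.\<close>

locale env =
  fixes n :: nat and S :: "gen set"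
  assumes br_closed: "x \<in> S \<Longrightarrow> y \<in> S \<Longrightarrow> br n x y \<in> carrier (free_alg S)"
begin

abbreviation "FA \<equiv> free_alg S"
abbreviation "I \<equiv> genideal FA (rels n S)"
abbreviation "U \<equiv> env_alg n S"
abbreviation "cls \<equiv> env_cls n S"

sublocale FA: Ring.ring FA by (rule ring_free_alg)

lemma rels_closed: "rels n S \<subseteq> carrier FA"
  unfolding rels_def using br_closed by (auto intro!: fa_diff_closed fa_mult_closed fa_gen_closed)

lemma ideal_I: "ideal I FA" by (rule FA.genideal_ideal[OF rels_closed])

lemma ring_U: "Ring.ring U"
  unfolding env_alg_def by (rule ideal.quotient_is_ring[OF ideal_I])

sublocale U: Ring.ring U by (rule ring_U)

lemma cls_hom: "cls \<in> ring_hom FA U"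
  using ideal.rcos_ring_hom[OF ideal_I] unfolding env_alg_def env_cls_def[abs_def] .

sublocale cls: ring_hom_ring FA U cls
  by (rule ring_hom_ringI2[OF ring_free_alg ring_U cls_hom])

lemma U_cases:
  assumes "X \<in> carrier U" obtains f where "f \<in> carrier FA" "X = cls f"
  using assms unfolding env_alg_def env_cls_def FactRing_def A_RCOSETS_def' by auto

lemma cls_rel:
  assumes "x \<in> S" "y \<in> S"
  shows "cls (fa_gen x) \<otimes>\<^bsub>U\<^esub> cls (fa_gen y) = cls (br n x y) \<oplus>\<^bsub>U\<^esub> cls (fa_gen y) \<otimes>\<^bsub>U\<^esub> cls (fa_gen x)"
proof -
  let ?d = "\<lambda>w. fa_mult (fa_gen x) (fa_gen y) w - fa_mult (fa_gen y) (fa_gen x) w"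
  note c = fa_gen_closed[OF assms(1)] fa_gen_closed[OF assms(2)] br_closed[OF assms]
  have m: "fa_mult (fa_gen x) (fa_gen y) \<in> carrier FA" "fa_mult (fa_gen y) (fa_gen x) \<in> carrier FA"
    by (intro fa_mult_closed c)+
  have "(\<lambda>w. ?d w - br n x y w) \<in> I"
    using FA.genideal_self[OF rels_closed] assms unfolding rels_def by blast
  then have "?d \<ominus>\<^bsub>FA\<^esub> br n x y \<in> I"
    unfolding free_alg_minus[OF fa_diff_closed[OF m] c(3)] .
  then have "cls ?d = cls (br n x y)"
    unfolding env_cls_def using FA.quotient_eq_iff_same_a_r_cos[OF ideal_I fa_diff_closed[OF m] c(3)] by simp
  moreover have "cls (fa_mult (fa_gen x) (fa_gen y)) = cls ?d \<oplus>\<^bsub>U\<^esub> cls (fa_mult (fa_gen y) (fa_gen x))"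
    using cls.hom_add[OF fa_diff_closed[OF m] m(2)] by simp
  ultimately show ?thesis
    using cls.hom_mult[OF c(1,2)] cls.hom_mult[OF c(2,1)] by simp
qed

end

lemma smult_gen_closed: "x \<in> S \<Longrightarrow> fa_smult c (fa_gen x) \<in> carrier (free_alg S)"
  by (intro fa_smult_closed fa_gen_closed)

interpretation g: env n "gens_g n" for n
proof
  fix x y assume "x \<in> gens_g n" "y \<in> gens_g n"
  then show "br n x y \<in> carrier (free_alg (gens_g n))"
    by (cases x; cases y)
       (auto simp: gens_g_def intro!: smult_gen_closed fa_gen_closed fa_zero_closed)
qed

interpretation H: env n "gens_H n" for n
proof
  fix x y assume "x \<in> gens_H n" "y \<in> gens_H n"
  then show "br n x y \<in> carrier (free_alg (gens_H n))"
    by (cases x; cases y)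
       (auto simp: gens_H_def intro!: smult_gen_closed fa_gen_closed fa_zero_closed)
qed

text \<open>The elements commuting with z form a subalgebra; it contains the scalars and, since
  \<open>br n GZ x\<close> is zero, the generators.\<close>

lemma zH_central:
  assumes "X \<in> carrier (UH n)"
  shows "zH n \<otimes>\<^bsub>UH n\<^esub> X = X \<otimes>\<^bsub>UH n\<^esub> zH n"
proof -
  have z: "fa_gen GZ \<in> carrier (free_alg (gens_H n))"
    by (rule fa_gen_closed) (simp add: gens_H_def)
  note zc = H.cls.hom_closed[OF z]
  obtain f where f: "f \<in> carrier (free_alg (gens_H n))" "X = clsH n f"
    using H.U_cases assms by blast
  from f(1) have "zH n \<otimes>\<^bsub>UH n\<^esub> clsH n f = clsH n f \<otimes>\<^bsub>UH n\<^esub> zH n"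
  proof (induction rule: free_alg_induct)
    case (scal c)
    have "fa_gen GZ \<otimes>\<^bsub>free_alg (gens_H n)\<^esub> fa_scal c = fa_scal c \<otimes>\<^bsub>free_alg (gens_H n)\<^esub> fa_gen GZ"
      by (simp only: free_alg_simps(2) fa_scal_mult mult_fa_scal)
    then show ?case
      using H.cls.hom_mult[OF z fa_scal_closed] H.cls.hom_mult[OF fa_scal_closed z] by metis
  next
    case (gen x)
    have "br n GZ x = \<zero>\<^bsub>free_alg (gens_H n)\<^esub>"
      using gen by (cases x) (auto simp: gens_H_def)
    then have "clsH n (br n GZ x) = \<zero>\<^bsub>UH n\<^esub>"
      using H.cls.hom_zero[of n] by simp
    moreover have "GZ \<in> gens_H n" by (simp add: gens_H_def)
    ultimately show ?case
      using zc H.cls.hom_closed[OF fa_gen_closed[OF gen]] H.cls_rel[of GZ n x] gen by simp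
  next
    case (add f g)
    note c = H.cls.hom_closed[OF add(1)] H.cls.hom_closed[OF add(2)]
    have "clsH n (\<lambda>w. f w + g w) = clsH n f \<oplus>\<^bsub>UH n\<^esub> clsH n g"
      using H.cls.hom_add[OF add(1,2)] by simp
    then show ?case using c zc add by (simp only: H.U.r_distr H.U.l_distr)
  next
    case (mult f g)
    note c = H.cls.hom_closed[OF mult(1)] H.cls.hom_closed[OF mult(2)]
    have "clsH n (fa_mult f g) = clsH n f \<otimes>\<^bsub>UH n\<^esub> clsH n g"
      using H.cls.hom_mult[OF mult(1,2)] by simp
    then show ?case using c zc mult by (metis H.U.m_assoc)
  qed
  then show ?thesis by (simp add: f)
qed

interpretation loc: central_element "UH n" "zH n" for n
proof
  show "zH n \<in> carrier (UH n)"
    by (rule H.cls.hom_closed[OF fa_gen_closed]) (simp add: gens_H_def)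
qed (rule zH_central)

interpretation ULoc: Ring.ring "ULoc n" for n by (rule loc.ring_localization)

section \<open>The Heisenberg configuration inside the localization\<close>

definition emb :: "nat \<Rightarrow> (gen list \<Rightarrow> complex) \<Rightarrow> ((gen list \<Rightarrow> complex) set \<times> nat) set" where
  "emb n f = loc_map n (clsH n f)"

lemma emb_hom: "emb n \<in> ring_hom (free_alg (gens_H n)) (ULoc n)"
proof -
  have "loc_map n \<in> ring_hom (UH n) (ULoc n)"
    unfolding loc_map_def[abs_def] by (rule loc.frac_0_hom)
  from ring_hom_trans[OF H.cls_hom this] show ?thesis
    by (simp add: emb_def[abs_def] comp_def)
qed

lemma emb_closed: "f \<in> carrier (free_alg (gens_H n)) \<Longrightarrow> emb n f \<in> carrier (ULoc n)"
  by (rule ring_hom_closed[OF emb_hom])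

lemma emb_rel:
  assumes "x \<in> gens_H n" "y \<in> gens_H n"
  shows "emb n (fa_gen x) \<otimes>\<^bsub>ULoc n\<^esub> emb n (fa_gen y)
    = emb n (br n x y) \<oplus>\<^bsub>ULoc n\<^esub> emb n (fa_gen y) \<otimes>\<^bsub>ULoc n\<^esub> emb n (fa_gen x)"
proof -
  have hom: "loc_map n \<in> ring_hom (UH n) (ULoc n)"
    unfolding loc_map_def[abs_def] by (rule loc.frac_0_hom)
  note c = H.cls.hom_closed[OF fa_gen_closed[OF assms(1)]] H.cls.hom_closed[OF fa_gen_closed[OF assms(2)]]
    H.cls.hom_closed[OF H.br_closed[OF assms]]
  show ?thesis
    unfolding emb_def using H.cls_rel[OF assms] c
    by (metis H.U.m_closed ring_hom_add[OF hom] ring_hom_mult[OF hom])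
qed

lemma zinv_closed: "zinv n \<in> carrier (ULoc n)"
  unfolding zinv_def by (rule loc.frac_closed) simp

lemma zinv_comm:
  "f \<in> carrier (free_alg (gens_H n)) \<Longrightarrow> zinv n \<otimes>\<^bsub>ULoc n\<^esub> emb n f = emb n f \<otimes>\<^bsub>ULoc n\<^esub> zinv n"
  unfolding zinv_def emb_def loc_map_def by (rule loc.frac_inverse_comm) (rule H.cls.hom_closed)

lemma zinv_emb_z: "zinv n \<otimes>\<^bsub>ULoc n\<^esub> emb n (fa_gen GZ) = \<one>\<^bsub>ULoc n\<^esub>"
  unfolding zinv_def emb_def loc_map_def by (rule loc.frac_inverse)

definition lift :: "nat \<Rightarrow> (gen list \<Rightarrow> complex) \<Rightarrow> ((gen list \<Rightarrow> complex) set \<times> nat) set fam" where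
  "lift n f = single (ULoc n) (emb n f)"

lemma lift_add:
  assumes "f \<in> carrier (free_alg (gens_H n))" "g \<in> carrier (free_alg (gens_H n))"
  shows "lift n (\<lambda>w. f w + g w) = lift n f + lift n g"
  using ring_hom_add[OF emb_hom assms] emb_closed assms
  by (simp add: lift_def single_hom(1) ULoc.ring_axioms)

lemma lift_mult:
  assumes "f \<in> carrier (free_alg (gens_H n))" "g \<in> carrier (free_alg (gens_H n))"
  shows "lift n (fa_mult f g) = lift n f * lift n g"
  using ring_hom_mult[OF emb_hom assms] emb_closed assms
  by (simp add: lift_def single_hom(3) ULoc.ring_axioms)

lemma lift_scal_comm:
  assumes "f \<in> carrier (free_alg (gens_H n))"
  shows "lift n (fa_scal c) * lift n f = lift n f * lift n (fa_scal c)"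
  using assms lift_mult[OF fa_scal_closed assms] lift_mult[OF assms fa_scal_closed]
  by (simp add: fa_scal_mult mult_fa_scal)

lemma lift_scal_1: "lift n (fa_scal 1) = single (ULoc n) \<one>\<^bsub>ULoc n\<^esub>"
  using ring_hom_one[OF emb_hom] by (simp add: lift_def)

lemma single_one_mult: "x \<in> carrier (ULoc n) \<Longrightarrow> lift n (fa_scal 1) * single (ULoc n) x = single (ULoc n) x"
  by (simp add: lift_scal_1 single_hom(3)[symmetric] ULoc.ring_axioms)

lemma lift_rel:
  assumes "x \<in> gens_H n" "y \<in> gens_H n"
  shows "comm (lift n (fa_gen x)) (lift n (fa_gen y)) = lift n (br n x y)"
proof -
  note c = emb_closed[OF fa_gen_closed[OF assms(1)]] emb_closed[OF fa_gen_closed[OF assms(2)]]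
    emb_closed[OF H.br_closed[OF assms]]
  have "lift n (fa_gen x) * lift n (fa_gen y) = lift n (br n x y) + lift n (fa_gen y) * lift n (fa_gen x)"
    unfolding lift_def using c emb_rel[OF assms] ULoc.ring_axioms
    by (simp add: single_hom[symmetric])
  then show ?thesis by (simp add: comm_def)
qed

lemma lift_zero: "lift n (\<lambda>w. 0) = 0"
  using lift_add[OF fa_zero_closed fa_zero_closed, of n] by simp

lemma lift_smult: "f \<in> carrier (free_alg (gens_H n)) \<Longrightarrow> lift n (fa_smult c f) = lift n (fa_scal c) * lift n f"
  by (simp only: fa_scal_mult[symmetric] lift_mult[OF fa_scal_closed])

text \<open>Membership and value are proved together because additivity of \<open>lift\<close> in
  the induction step presupposes membership.\<close>

lemma lift_lincomb:
  assumes "\<And>k. k \<in> K \<Longrightarrow> a k \<in> carrier (free_alg (gens_H n))"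
  shows "(\<lambda>w. \<Sum>k\<in>K. c k * a k w) \<in> carrier (free_alg (gens_H n)) \<and>
    lift n (\<lambda>w. \<Sum>k\<in>K. c k * a k w) = (\<Sum>k\<in>K. lift n (fa_scal (c k)) * lift n (a k))"
  using assms
proof (induction K rule: infinite_finite_induct)
  case (insert k K)
  then have "fa_smult (c k) (a k) \<in> carrier (free_alg (gens_H n))"
    "(\<lambda>w. \<Sum>k\<in>K. c k * a k w) \<in> carrier (free_alg (gens_H n))"
    by (auto intro!: fa_smult_closed)
  from fa_add_closed[OF this] lift_add[OF this] insert show ?case
    by (simp add: fa_smult_def[symmetric] lift_smult) (simp add: fa_smult_def)
qed (simp_all add: lift_zero fa_zero_closed)

lemma GP_in: "k \<le> 2*n+1 \<Longrightarrow> GP k \<in> gens_H n" and GZ_in: "GZ \<in> gens_H n"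
  by (auto simp: gens_H_def)

definition hsc :: "nat \<Rightarrow> complex \<Rightarrow> ((gen list \<Rightarrow> complex) set \<times> nat) set fam" where
  "hsc n c = lift n (fa_scal c)"

text \<open>The value zero beyond index 2l makes the relations of \<open>heisenberg\<close> true for
  all natural indices.\<close>

definition hp :: "nat \<Rightarrow> nat \<Rightarrow> ((gen list \<Rightarrow> complex) set \<times> nat) set fam" where
  "hp n k = (if k \<le> 2*n+1 then lift n (fa_gen (GP k)) else 0)"

definition hz :: "nat \<Rightarrow> ((gen list \<Rightarrow> complex) set \<times> nat) set fam" where
  "hz n = lift n (fa_gen GZ)"

definition hzi :: "nat \<Rightarrow> ((gen list \<Rightarrow> complex) set \<times> nat) set fam" where
  "hzi n = single (ULoc n) (zinv n)"

interpretation heis: heisenberg n "hsc n" "hp n" "hz n" "hzi n" for n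
proof
  note z = fa_gen_closed[OF GZ_in[of n]]
  have zi: "hzi n * lift n f = lift n f * hzi n" if "f \<in> carrier (free_alg (gens_H n))" for f
    using that zinv_comm emb_closed zinv_closed ULoc.ring_axioms
    by (simp add: hzi_def lift_def single_hom(3)[symmetric])
  show "hsc n (a + b) = hsc n a + hsc n b" for a b
  proof -
    have "fa_scal (a + b) = (\<lambda>w :: gen list. fa_scal a w + fa_scal b w)"
      by (auto simp: fa_scal_def)
    then show ?thesis using lift_add[OF fa_scal_closed fa_scal_closed] by (simp add: hsc_def)
  qed
  show "hsc n (a * b) = hsc n a * hsc n b" for a b
  proof -
    have "fa_scal (a * b) = fa_mult (fa_scal a) (fa_scal b :: gen list \<Rightarrow> complex)"
      by (simp only: fa_scal_mult) (auto simp: fa_scal_def fa_smult_def)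
    then show ?thesis using lift_mult[OF fa_scal_closed fa_scal_closed] by (simp add: hsc_def)
  qed
  show "comm (hsc n a) (hp n k) = 0" for a k
    using lift_scal_comm[OF fa_gen_closed[OF GP_in]] by (simp add: comm_def hsc_def hp_def)
  show "comm (hsc n a) (hzi n) = 0" for a
    using zi[OF fa_scal_closed] by (simp add: comm_def hsc_def)
  show "hsc n 1 * hp n k = hp n k" for k
    using single_one_mult emb_closed[OF fa_gen_closed[OF GP_in]] by (simp add: hsc_def hp_def lift_def[of n "fa_gen _"])
  show "comm (hsc n a) (hz n) = 0" for a
    using lift_scal_comm[OF z] by (simp add: comm_def hsc_def hz_def)
  show "hsc n 1 * hz n = hz n"
    unfolding hsc_def hz_def lift_def[of n "fa_gen GZ"] by (rule single_one_mult[OF emb_closed[OF z]])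
  show "comm (hz n) (hzi n) = 0"
    using zi[OF z] by (simp add: comm_def hz_def)
  show "comm (hz n) (hp n k) = 0" for k
    using lift_rel[OF GZ_in GP_in] lift_zero by (auto simp: comm_def hz_def hp_def)
  show "comm (hzi n) (hp n k) = 0" for k
    using zi[OF fa_gen_closed[OF GP_in]] by (auto simp: comm_def hp_def)
  show "hzi n * hz n = hsc n 1"
    using zinv_emb_z emb_closed[OF z] zinv_closed ULoc.ring_axioms
    by (simp add: hsc_def hzi_def hz_def lift_scal_1 lift_def[of n "fa_gen GZ"] single_hom(3)[symmetric])
  show "comm (hp n j) (hp n k)
    = (if j + k = 2*n+1 then hsc n ((-1) ^ (j + n + 1) * of_nat (fact j * fact (2*n+1-j))) * hz n else 0)" for j k
  \<comment> \<open>If an index is out of range, its \<open>hp\<close> is zero and j + k cannot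
    equal 2n + 1, so both sides vanish.\<close>
  proof (cases "j \<le> 2*n+1 \<and> k \<le> 2*n+1")
    case True
    then show ?thesis
      using lift_rel[OF GP_in GP_in, of j n k] by (simp add: lift_smult[OF z] lift_zero hsc_def hp_def hz_def)
  qed (auto simp: comm_def hp_def)
qed

lemma quad_lift:
  assumes "i \<le> 2*n+1" "j \<le> 2*n+1"
  shows "heis.quad n a i j = hzi n * (hsc n a * lift n (fa_mult (fa_gen (GP i)) (fa_gen (GP j))))"
  using assms lift_mult[OF fa_gen_closed[OF GP_in] fa_gen_closed[OF GP_in]]
  by (simp add: heis.quad_def hp_def)

lemma lift_quad_sum:
  fixes c :: "nat \<Rightarrow> complex"
  assumes "\<And>k. k \<in> K \<Longrightarrow> i k \<le> 2*n+1 \<and> j k \<le> 2*n+1"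
  defines "q \<equiv> (\<lambda>w. \<Sum>k\<in>K. c k * fa_mult (fa_gen (GP (i k))) (fa_gen (GP (j k))) w)"
  shows "q \<in> carrier (free_alg (gens_H n))"
    and "hzi n * lift n q = (\<Sum>k\<in>K. heis.quad n (c k) (i k) (j k))"
proof -
  have "fa_mult (fa_gen (GP (i k))) (fa_gen (GP (j k))) \<in> carrier (free_alg (gens_H n))" if "k \<in> K" for k
    using assms(1)[OF that] by (intro fa_mult_closed fa_gen_closed GP_in) auto
  from lift_lincomb[of K "\<lambda>k. fa_mult (fa_gen (GP (i k))) (fa_gen (GP (j k)))", OF this, of c]
  have q: "q \<in> carrier (free_alg (gens_H n))"
    and l: "lift n q = (\<Sum>k\<in>K. hsc n (c k) * lift n (fa_mult (fa_gen (GP (i k))) (fa_gen (GP (j k)))))"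
    by (simp_all add: q_def hsc_def)
  show "q \<in> carrier (free_alg (gens_H n))" by (rule q)
  show "hzi n * lift n q = (\<Sum>k\<in>K. heis.quad n (c k) (i k) (j k))"
    unfolding l sum_distrib_left by (intro sum.cong refl) (metis quad_lift assms(1))
qed

lemma E_sum_closed: "E_sum n \<in> carrier (free_alg (gens_H n))"
  and F_sum_closed: "F_sum n \<in> carrier (free_alg (gens_H n))"
  and H_sum_closed: "H_sum n \<in> carrier (free_alg (gens_H n))"
  unfolding E_sum_def F_sum_def H_sum_def by (rule lift_quad_sum; simp; linarith)+

lemma Eel_closed: "Eel n \<in> carrier (ULoc n)"
  and Fel_closed: "Fel n \<in> carrier (ULoc n)"
  and Hel_closed: "Hel n \<in> carrier (ULoc n)"
  unfolding Eel_def Fel_def Hel_def emb_def[symmetric]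
  by (intro ULoc.m_closed ULoc.minus_closed zinv_closed emb_closed E_sum_closed F_sum_closed
      H_sum_closed fa_scal_closed)+

lemma E_eq: "heis.E n = single (ULoc n) (Eel n)"
proof -
  have "heis.E n = hzi n * lift n (E_sum n)"
    unfolding heis.E_def heis.Ec_def heis.N_def E_sum_def by (rule lift_quad_sum(2)[symmetric]) auto
  then show ?thesis
    unfolding Eel_def emb_def[symmetric] lift_def hsc_def hzi_def
    by (simp only: single_hom(3)[OF ULoc.ring_axioms zinv_closed emb_closed[OF E_sum_closed]])
qed

lemma F_eq: "heis.F n = single (ULoc n) (Fel n)"
proof -
  have "heis.F n = hzi n * lift n (F_sum n)"
    unfolding heis.F_def heis.Fc_def heis.N_def F_sum_def by (rule lift_quad_sum(2)[symmetric]) auto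
  then show ?thesis
    unfolding Fel_def emb_def[symmetric] lift_def hsc_def hzi_def
    by (simp only: single_hom(3)[OF ULoc.ring_axioms zinv_closed emb_closed[OF F_sum_closed]])
qed

lemma H_eq: "heis.H n = single (ULoc n) (Hel n)"
proof -
  have "heis.H n = hsc n 2 * (\<Sum>k\<in>{0..n}. heis.quad n (heis.Hc n k) (2*n+1 - k) k)
      - hsc n ((lc n + 1/2)^2 / 2)"
    \<comment> \<open>\<open>Hel\<close> has the scalar 2 as a separate factor, whereas
      \<open>heis.H\<close> carries it in each coefficient.\<close>
    unfolding heis.H_def heis.N_def sum_distrib_left heis.sc_quad ..
  also have "(\<Sum>k\<in>{0..n}. heis.quad n (heis.Hc n k) (2*n+1 - k) k) = hzi n * lift n (H_sum n)"
    unfolding heis.Hc_def heis.N_def H_sum_def by (rule lift_quad_sum(2)[symmetric]) auto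
  finally show ?thesis
    unfolding Hel_def emb_def[symmetric] lift_def hsc_def hzi_def
    by (simp only: single_hom(2,3) ULoc.ring_axioms zinv_closed emb_closed H_sum_closed fa_scal_closed
        ULoc.m_closed mult.assoc)
qed

section \<open>The homomorphism and its uniqueness\<close>

definition Phi_free :: "nat \<Rightarrow> (gen list \<Rightarrow> complex) \<Rightarrow> ((gen list \<Rightarrow> complex) set \<times> nat) set" where
  "Phi_free n f = component (ULoc n) (heis.ev.ev n f)"

lemma Phi_free_scal: "Phi_free n (fa_scal c) = emb n (fa_scal c)"
  unfolding Phi_free_def heis.ev.ev_scal hsc_def lift_def
  by (rule component_single[OF ULoc.ring_axioms emb_closed[OF fa_scal_closed]])

lemma Phi_free_E: "Phi_free n (fa_gen GE) = Eel n"
  and Phi_free_F: "Phi_free n (fa_gen GF) = Fel n"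
  and Phi_free_H: "Phi_free n (fa_gen GH) = Hel n"
  unfolding Phi_free_def heis.ev.ev_gen heis.image_gen_simps E_eq F_eq H_eq
  by (intro component_single ULoc.ring_axioms Eel_closed Fel_closed Hel_closed)+

lemma Phi_free_gen_H:
  assumes "x \<in> gens_H n"
  shows "Phi_free n (fa_gen x) = emb n (fa_gen x)"
proof -
  have "heis.image_gen n x = lift n (fa_gen x)"
    using assms unfolding gens_H_def
    by (elim UnE imageE singletonE) (simp_all only: heis.image_gen_simps, simp_all add: hz_def hp_def)
  then show ?thesis
    unfolding Phi_free_def heis.ev.ev_gen lift_def
    using component_single[OF ULoc.ring_axioms emb_closed[OF fa_gen_closed[OF assms]]] by simp
qed

text \<open>Evaluation does not refer to the set of generators, so \<open>S\<close> is arbitrary: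
  the map is used on the free algebra of the whole Lie algebra and compared with \<open>emb\<close>
  on that of the Heisenberg part.\<close>

lemma Phi_free_hom: "Phi_free n \<in> ring_hom (free_alg S) (ULoc n)"
proof (rule ring_hom_memI)
  fix f g assume "f \<in> carrier (free_alg S)" "g \<in> carrier (free_alg S)"
  then have fin: "finite {w. f w \<noteq> 0}" "finite {w. g w \<noteq> 0}" by (simp_all add: mem_free_alg)
  show "Phi_free n (f \<otimes>\<^bsub>free_alg S\<^esub> g) = Phi_free n f \<otimes>\<^bsub>ULoc n\<^esub> Phi_free n g"
    unfolding Phi_free_def free_alg_simps heis.ev.ev_mult[OF fin]
    by (rule component_hom(3)[OF ULoc.ring_axioms])
  show "Phi_free n (f \<oplus>\<^bsub>free_alg S\<^esub> g) = Phi_free n f \<oplus>\<^bsub>ULoc n\<^esub> Phi_free n g"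
    unfolding Phi_free_def free_alg_simps heis.ev.ev_add[OF fin]
    by (rule component_hom(2)[OF ULoc.ring_axioms])
next
  show "Phi_free n f \<in> carrier (ULoc n)" for f
    unfolding Phi_free_def by (rule component_closed[OF ULoc.ring_axioms])
  show "Phi_free n \<one>\<^bsub>free_alg S\<^esub> = \<one>\<^bsub>ULoc n\<^esub>"
    using ring_hom_one[OF emb_hom] by (simp add: Phi_free_scal)
qed

lemma Phi_free_emb: "f \<in> carrier (free_alg (gens_H n)) \<Longrightarrow> Phi_free n f = emb n f"
  by (rule free_alg_hom_unique[OF Phi_free_hom emb_hom]) (simp_all add: Phi_free_scal Phi_free_gen_H)

lemma Phi_free_rels:
  assumes "r \<in> rels n (gens_g n)"
  shows "Phi_free n r = \<zero>\<^bsub>ULoc n\<^esub>"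
proof -
  obtain x y where xy: "x \<in> gens_g n" "y \<in> gens_g n"
    and r: "r = (\<lambda>w. fa_mult (fa_gen x) (fa_gen y) w - fa_mult (fa_gen y) (fa_gen x) w - br n x y w)"
    using assms unfolding rels_def by blast
  note c = fa_gen_closed[OF xy(1)] fa_gen_closed[OF xy(2)]
  note m = fa_mult_closed[OF c] fa_mult_closed[OF c(2,1)]
  have mult: "heis.ev.ev n (fa_mult (fa_gen u) (fa_gen v)) = heis.image_gen n u * heis.image_gen n v" for u v
  proof -
    have "finite {w. fa_gen u w \<noteq> 0}" "finite {w. fa_gen v w \<noteq> 0}" by (simp_all add: fa_gen_def)
    then show ?thesis by (simp only: heis.ev.ev_mult heis.ev.ev_gen)
  qed
  have "heis.ev.ev n r = 0"
    unfolding r heis.ev_diff[OF fa_diff_closed[OF m] g.br_closed[OF xy]] heis.ev_diff[OF m] mult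
      heis.comm_image_gen[OF xy, symmetric] by (simp add: comm_def)
  then show ?thesis by (simp add: Phi_free_def component_hom(1)[OF ULoc.ring_axioms])
qed

text \<open>The kernel is an ideal containing the relations, hence also the ideal generated by
  them.\<close>

lemma Phi_free_ideal:
  assumes "f \<in> genideal (free_alg (gens_g n)) (rels n (gens_g n))"
  shows "Phi_free n f = \<zero>\<^bsub>ULoc n\<^esub>"
proof -
  interpret Phi:  ring_hom_ring "free_alg (gens_g n)" "ULoc n" "Phi_free n"
    by (rule ring_hom_ringI2[OF ring_free_alg ULoc.ring_axioms Phi_free_hom])
  let ?K = "a_kernel (free_alg (gens_g n)) (ULoc n) (Phi_free n)"
  have "rels n (gens_g n) \<subseteq> ?K"
    using Phi_free_rels g.rels_closed unfolding a_kernel_def' by blast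
  then have "genideal (free_alg (gens_g n)) (rels n (gens_g n)) \<subseteq> ?K"
    by (rule g.FA.genideal_minimal[OF Phi.kernel_is_ideal])
  then show ?thesis using assms unfolding a_kernel_def' by blast
qed

lemma gens_H_subset: "gens_H n \<subseteq> gens_g n"
  by (auto simp: gens_H_def gens_g_def)

lemma free_alg_mono: "S \<subseteq> T \<Longrightarrow> f \<in> carrier (free_alg S) \<Longrightarrow> f \<in> carrier (free_alg T)"
  by (auto simp: mem_free_alg)

lemma Phi_exists: "\<exists>\<Phi>. Phi_prop n \<Phi>"
proof -
  obtain \<Phi> where hom: "\<Phi> \<in> ring_hom (Ug n) (ULoc n)"
    and \<Phi>: "\<And>f. f \<in> carrier (free_alg (gens_g n)) \<Longrightarrow> \<Phi> (clsg n f) = Phi_free n f"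
    using quot_factor[OF g.ideal_I ULoc.ring_axioms Phi_free_hom Phi_free_ideal]
    unfolding env_alg_def env_cls_def by metis
  have gen: "fa_gen x \<in> carrier (free_alg (gens_g n))" if "x \<in> {GE, GF, GH}" for x
    using that by (intro fa_gen_closed) (auto simp: gens_g_def)
  have "\<Phi> (clsg n (fa_scal c) \<otimes>\<^bsub>Ug n\<^esub> x) = loc_map n (clsH n (fa_scal c)) \<otimes>\<^bsub>ULoc n\<^esub> \<Phi> x"
    if "x \<in> carrier (Ug n)" for c x
    using ring_hom_mult[OF hom g.cls.hom_closed[OF fa_scal_closed] that, of c] \<Phi>[OF fa_scal_closed, of c]
    by (simp add: Phi_free_scal emb_def)
  moreover have "\<Phi> (clsg n f) = loc_map n (clsH n f)" if "f \<in> carrier (free_alg (gens_H n))" for f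
    using \<Phi>[OF free_alg_mono[OF gens_H_subset that]] Phi_free_emb[OF that] by (simp add: emb_def)
  ultimately show ?thesis
    unfolding Phi_prop_def using hom gen by (intro exI[of _ \<Phi>]) (simp add: \<Phi> Phi_free_E Phi_free_F Phi_free_H)
qed

lemma Phi_unique:
  assumes "Phi_prop n \<Phi>" "Phi_prop n \<Psi>" "x \<in> carrier (Ug n)"
  shows "\<Phi> x = \<Psi> x"
proof -
  obtain f where f: "f \<in> carrier (free_alg (gens_g n))" "x = clsg n f"
    using g.U_cases assms(3) by blast
  have hom: "\<Theta> \<circ> clsg n \<in> ring_hom (free_alg (gens_g n)) (ULoc n)" if "Phi_prop n \<Theta>" for \<Theta>
    using that ring_hom_trans[OF g.cls_hom] unfolding Phi_prop_def by blast
  have H: "\<Phi> (clsg n a) = \<Psi> (clsg n a)" if "a \<in> carrier (free_alg (gens_H n))" for a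
    using assms(1,2) that unfolding Phi_prop_def by simp
  have "(\<Phi> \<circ> clsg n) f = (\<Psi> \<circ> clsg n) f"
  proof (rule free_alg_hom_unique[OF hom[OF assms(1)] hom[OF assms(2)] _ _ f(1)])
    \<comment> \<open>Scalars already lie in the free algebra on \<open>gens_H n\<close>, where both
      maps are prescribed.\<close>
    show "(\<Phi> \<circ> clsg n) (fa_scal c) = (\<Psi> \<circ> clsg n) (fa_scal c)" for c
      using H[OF fa_scal_closed] by simp
    show "(\<Phi> \<circ> clsg n) (fa_gen y) = (\<Psi> \<circ> clsg n) (fa_gen y)" if "y \<in> gens_g n" for y
    proof (cases "y \<in> gens_H n")
      case True
      then show ?thesis using H[OF fa_gen_closed] by simp
    next
      case False
      then have "y \<in> {GE, GF, GH}" using that by (auto simp: gens_g_def gens_H_def)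
      then show ?thesis using assms(1,2) unfolding Phi_prop_def by auto
    qed
  qed
  then show ?thesis by (simp add: f)
qed

theorem theorem1:
  fixes n :: nat
  shows "(\<exists>\<Phi>. Phi_prop n \<Phi>) \<and>
         (\<forall>\<Phi> \<Psi>. Phi_prop n \<Phi> \<and> Phi_prop n \<Psi> \<longrightarrow> (\<forall>x\<in>carrier (Ug n). \<Phi> x = \<Psi> x))"
  using Phi_exists Phi_unique by blast

end
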